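(* Let $n\ge 2$ and $\varphi_1,\varphi_2\in\Phi$. For all compact convex sets $K,L$ in $\mathbb{R}^n$ with $o\in\operatorname{int}K$ and $o\in L$, we have $$V_{\varphi_2}(K,L)=\frac{(\varphi_1)'_l(1)}{n}\lim_{\varepsilon\to 0+}\frac{V(K+_{\varphi,\varepsilon}L)-V(K)}{\varepsilon}.$$
   Context: $\Phi$ is the set of convex functions $\varphi:[0,\infty)\to[0,\infty)$ that are increasing (i.e. nondecreasing) and satisfy $\varphi(0)=0$ and $\varphi(1)=1$. $f'_l$ denotes the left derivative of $f$. $V$ is $n$-dimensional volume, $h_K(x)=\sup\{x\cdot y:y\in K\}$ is the support function, and $S(K,\cdot)$ is the surface area measure of $K$ on $S^{n-1}$. For $\varphi\in\Phi$, $K$ a compact convex set with $o\in\operatorname{int}K$, and $L$ a compact convex set containing $o$, the Orlicz mixed volume is $$V_\varphi(K,L)=\frac1n\int_{S^{n-1}}\varphi\left(\frac{h_L(u)}{h_K(u)}\right)h_K(u)\,dS(K,u).$$ For $\varphi_1,\varphi_2\in\Phi$, $\varepsilon\ge 0$, and compact convex sets $K,L$ containing $o$, the Orlicz linear combination $K+_{\varphi,\varepsilon}L$ is the compact convex set with support function $$h_{K+_{\varphi,\varepsilon}L}(x)=\inf\left\{\lambda>0:\varphi_1\left(\frac{h_K(x)}{\lambda}\right)+\varepsilon\,\varphi_2\left(\frac{h_L(x)}{\lambda}\right)\le 1\right\},\quad x\in\mathbb{R}^n.$$ *)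

theory Defs
  imports "HOL-Analysis.Analysis"
begin

(* Elements of the class Phi live on [0,\<infinity>); they are represented by total functions on the
   reals whose values at negative arguments are irrelevant. *)

definition orlicz_class :: "(real \<Rightarrow> real) set" where
  "orlicz_class = {\<phi>. convex_on {0..} \<phi> \<and> mono_on {0..} \<phi> \<and> (\<forall>t\<ge>0. 0 \<le> \<phi> t) \<and> \<phi> 0 = 0 \<and> \<phi> 1 = 1}"

definition left_deriv :: "(real \<Rightarrow> real) \<Rightarrow> real \<Rightarrow> real" where
  "left_deriv f x = (THE D. (f has_real_derivative D) (at_left x))"

definition volume :: "'a::euclidean_space set \<Rightarrow> real" where
  "volume A = measure lborel A"

definition support_function :: "'a::euclidean_space set \<Rightarrow> 'a \<Rightarrow> real" where
  "support_function K x = (SUP y\<in>K. x \<bullet> y)"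

(* The points outside K at distance at most t from K whose direction
   u(K,x) = (x - p(K,x)) / d(K,x) from the metric projection p(K,x) onto K lies in E. *)

definition local_parallel_set :: "'a::euclidean_space set \<Rightarrow> real \<Rightarrow> 'a set \<Rightarrow> 'a set" where
  "local_parallel_set K t E =
     {x. 0 < infdist x K \<and> infdist x K \<le> t \<and>
         (x - closest_point K x) /\<^sub>R infdist x K \<in> E}"

(* The surface area measure of a compact convex set, a Borel measure on the unit sphere, as
   defined through the local Steiner formula (Fenchel-Jessen, Aleksandrov; Schneider, "Convex
   Bodies: The Brunn-Minkowski Theory", Section 4.2): S(K,E) is the coefficient of t in the
   polynomial t \<mapsto> V(local_parallel_set K t E), which has no constant term, that is, its
   right derivative at 0.
   As always with measure_of, this would be the null measure if the set function were not
   countably additive; for nonempty compact convex K it is. *)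

definition surface_area_measure :: "'a::euclidean_space set \<Rightarrow> 'a measure" where
  "surface_area_measure K =
     measure_of (sphere 0 1) (sets (restrict_space borel (sphere 0 1)))
       (\<lambda>E. Lim (at_right 0) (\<lambda>t::real. emeasure lborel (local_parallel_set K t E) / ennreal t))"

definition orlicz_mixed_volume ::
    "(real \<Rightarrow> real) \<Rightarrow> 'a::euclidean_space set \<Rightarrow> 'a set \<Rightarrow> real" where
  "orlicz_mixed_volume \<phi> K L =
     1 / real DIM('a) *
       (\<integral>u. \<phi> (support_function L u / support_function K u) * support_function K u
          \<partial>surface_area_measure K)"

definition orlicz_comb_support ::
    "(real \<Rightarrow> real) \<Rightarrow> (real \<Rightarrow> real) \<Rightarrow> real \<Rightarrow> 'a::euclidean_space set \<Rightarrow> 'a set \<Rightarrow> 'a \<Rightarrow> real" where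
  "orlicz_comb_support \<phi>1 \<phi>2 \<epsilon> K L x =
     Inf {l. 0 < l \<and> \<phi>1 (support_function K x / l) + \<epsilon> * \<phi>2 (support_function L x / l) \<le> 1}"

definition orlicz_comb ::
    "(real \<Rightarrow> real) \<Rightarrow> (real \<Rightarrow> real) \<Rightarrow> real \<Rightarrow> 'a::euclidean_space set \<Rightarrow> 'a set \<Rightarrow> 'a set" where
  "orlicz_comb \<phi>1 \<phi>2 \<epsilon> K L =
     (THE M. compact M \<and> convex M \<and> M \<noteq> {} \<and>
        (\<forall>x. support_function M x = orlicz_comb_support \<phi>1 \<phi>2 \<epsilon> K L x))"

end

theory Submission
  imports Defs
begin

text \<open>
  For \<open>x\<close> outside a convex body \<open>M\<close> let \<open>u(x)\<close> be the outer normal at the nearest point. Since \<open>u\<close> is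
  monotone, \<open>x \<mapsto> x + h u(x)\<close> expands distances, hence volumes. So the volume of the local parallel set
  is a function of \<open>t\<close> with nondecreasing increments, its quotient by \<open>t\<close> decreases to the surface area
  measure as \<open>t \<rightarrow> 0\<close>, and countable additivity follows by monotone convergence.

  Let \<open>K \<subseteq> M\<^sub>\<epsilon>\<close> have support functions \<open>h\<^sub>K\<close> and \<open>h\<^sub>K + \<epsilon> g + o(\<epsilon>)\<close>. A point of \<open>M\<^sub>\<epsilon> - K\<close> with normal \<open>u\<close> has
  distance at most \<open>\<epsilon> (g u + o(1))\<close> from \<open>K\<close>, which bounds the growth of volume above by \<open>\<epsilon> \<integral>g dS(K)\<close>.
  Dually, a point of \<open>K + \<epsilon> c B\<close> outside \<open>M\<^sub>\<epsilon>\<close>, with \<open>B\<close> the unit ball, has distance at most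
  \<open>\<epsilon> (c - g u + o(1))\<close> from \<open>M\<^sub>\<epsilon>\<close>, which yields the lower bound without any regularity of the boundary.
  For the Orlicz combination, \<open>g = h\<^sub>K \<phi>\<^sub>2 (h\<^sub>L / h\<^sub>K) / (\<phi>\<^sub>1)'\<^sub>l (1)\<close>.
\<close>

text \<open>The difficulty is the lower bound. A direct argument would place a layer of thickness
  about \<open>\<epsilon> * g u\<close> over K inside the larger body, but over a corner of K a
  point at that distance in direction u may be cut off by a neighbouring direction with smaller g.
  Bounding the complement of the larger body inside a parallel body turns the task into an upper
  bound, now for a layer over a body that changes with \<epsilon>. The monotone quotient trades the
  small scale \<epsilon> for a fixed one, at which convergence of nearest points and dominated
  convergence suffice. Layers of variable thickness reduce to local parallel sets by cutting the
  sphere into level bands of the thickness. The interior point o keeps the support function of K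
  away from 0 on the sphere, so its ratio with that of L stays in a compact interval and the Orlicz
  expansion is uniform in the direction. The left derivative enters because the ratio of h_K to the
  root tends to 1 from below.\<close>

section \<open>Volume under expanding maps\<close>

text \<open>A Vitali covering takes the place of derivatives: almost all of \<open>S\<close> lies in
  disjoint balls centred in \<open>S\<close>, of total volume at most that of \<open>S\<close> plus
  \<open>e\<close>. The part of \<open>S\<close> in such a ball is mapped into the ball of the same
  radius about the image of the centre, and the null remainder has a null image because
  \<open>f\<close> is Lipschitz.\<close>

lemma emeasure_nonexpanding_image_le:
  fixes f :: "'a::euclidean_space \<Rightarrow> 'a"
  assumes S: "S \<in> sets lebesgue" and f: "\<And>x y. x \<in> S \<Longrightarrow> y \<in> S \<Longrightarrow> dist (f x) (f y) \<le> dist x y"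
  shows "emeasure lebesgue (f ` S) \<le> emeasure lebesgue S"
proof (rule ennreal_le_epsilon)
  fix e :: real
  assume "e > 0"
  obtain T where T: "open T" "S \<subseteq> T" "T - S \<in> lmeasurable" "emeasure lebesgue (T - S) < ennreal e"
    using sets_lebesgue_outer_open[OF S \<open>e > 0\<close>] .
  define K where "K = {(x, r). x \<in> S \<and> 0 < r \<and> ball x r \<subseteq> T}"
  have cov: "\<exists>i. i \<in> K \<and> x \<in> ball (fst i) (snd i) \<and> snd i < d" if "x \<in> S" "0 < d" for x d
  proof -
    obtain r where r: "r > 0" "ball x r \<subseteq> T"
      using T \<open>x \<in> S\<close> by (meson open_contains_ball subsetD)
    show ?thesis
      by (rule exI[of _ "(x, min r (d/2))"]) (use r that in \<open>auto simp: K_def\<close>)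
  qed
  obtain C where C: "countable C" "C \<subseteq> K"
      "pairwise (\<lambda>i j. disjnt (ball (fst i) (snd i)) (ball (fst j) (snd j))) C"
      "negligible (S - (\<Union>i\<in>C. ball (fst i) (snd i)))"
    by (rule Vitali_covering_theorem_balls[OF cov])
  define N where "N = S - (\<Union>i\<in>C. ball (fst i) (snd i))"
  have negl: "negligible (f ` N)"
  proof (rule negligible_locally_Lipschitz_image)
    show "negligible N" using C(4) by (simp add: N_def)
    show "\<exists>T B. open T \<and> x \<in> T \<and> (\<forall>y\<in>N \<inter> T. norm (f y - f x) \<le> B * norm (y - x))" if "x \<in> N" for x
      by (rule exI[of _ UNIV], rule exI[of _ 1]) (use f that in \<open>auto simp: N_def dist_norm\<close>)
  qed simp
  \<comment> \<open>\<open>A\<close> and \<open>B\<close> list the covering balls and the balls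
    about the image centres as sequences; since \<open>to_nat_on\<close> is injective on
    \<open>C\<close>, each term is a single ball or empty.\<close>
  define A where "A = (\<lambda>n. \<Union>i\<in>{i\<in>C. to_nat_on C i = n}. ball (fst i) (snd i))"
  define B where "B = (\<lambda>n. \<Union>i\<in>{i\<in>C. to_nat_on C i = n}. ball (f (fst i)) (snd i))"
  have inj: "inj_on (to_nat_on C) C"
    by (rule inj_on_to_nat_on[OF C(1)])
  have AB: "emeasure lebesgue (B n) = emeasure lebesgue (A n)" for n
  proof (cases "\<exists>i\<in>C. to_nat_on C i = n")
    case True
    then obtain i where "i \<in> C" "to_nat_on C i = n" by blast
    with inj have "{i\<in>C. to_nat_on C i = n} = {i}" by (auto dest: inj_onD)
    moreover have "0 \<le> snd i" using \<open>i \<in> C\<close> C(2) by (auto simp: K_def)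
    ultimately show ?thesis
      by (simp add: A_def B_def emeasure_ball)
  next
    case False
    then have "{i\<in>C. to_nat_on C i = n} = {}" by auto
    then show ?thesis by (simp only: A_def B_def UN_empty)
  qed
  have disj: "disjoint_family A"
    unfolding disjoint_family_on_def
  proof (intro ballI impI)
    fix m n :: nat assume "m \<noteq> n"
    show "A m \<inter> A n = {}"
    proof (rule ccontr)
      assume "A m \<inter> A n \<noteq> {}"
      then obtain x i j where *: "i \<in> C" "j \<in> C" "to_nat_on C i = m" "to_nat_on C j = n"
          "x \<in> ball (fst i) (snd i)" "x \<in> ball (fst j) (snd j)"
        unfolding A_def by blast
      then have "i \<noteq> j" using \<open>m \<noteq> n\<close> by auto
      then show False using C(3) * unfolding pairwise_def disjnt_def by blast
    qed
  qed
  have opA: "A n \<in> sets lebesgue" "B n \<in> sets lebesgue" for n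
    proof -
    have "open (A n)" "open (B n)" unfolding A_def B_def by (rule open_UN, simp)+
    then show "A n \<in> sets lebesgue" "B n \<in> sets lebesgue" by (simp_all add: lborelD)
  qed
  have "f ` S \<subseteq> f ` N \<union> (\<Union>n. B n)"
  proof
    fix y assume "y \<in> f ` S"
    then obtain x where x: "x \<in> S" "y = f x" by auto
    show "y \<in> f ` N \<union> (\<Union>n. B n)"
    proof (cases "x \<in> N")
      case False
      then obtain i where i: "i \<in> C" "x \<in> ball (fst i) (snd i)" using x by (auto simp: N_def)
      then have "fst i \<in> S" using C(2) by (auto simp: K_def)
      with f[of "fst i" x] x i have "y \<in> ball (f (fst i)) (snd i)" by auto
      with i have "y \<in> B (to_nat_on C i)" unfolding B_def by blast
      then show ?thesis by blast
    qed (use x in auto)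
  qed
  then have "emeasure lebesgue (f ` S) \<le> emeasure lebesgue (f ` N \<union> (\<Union>n. B n))"
    using negl opA by (intro emeasure_mono) (auto simp: negligible_imp_sets)
  also have "\<dots> \<le> emeasure lebesgue (f ` N) + emeasure lebesgue (\<Union>n. B n)"
    using negl opA by (intro emeasure_subadditive) (auto simp: negligible_imp_sets)
  also have "\<dots> = emeasure lebesgue (\<Union>n. B n)"
    using negl negligible_iff_emeasure0[OF negligible_imp_sets[OF negl]] by simp
  also have "\<dots> \<le> (\<Sum>n. emeasure lebesgue (B n))"
    using opA by (intro emeasure_subadditive_countably) auto
  also have "\<dots> = (\<Sum>n. emeasure lebesgue (A n))"
    by (simp add: AB)
  also have "\<dots> = emeasure lebesgue (\<Union>n. A n)"
    using opA disj by (intro suminf_emeasure) auto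
  also have "\<dots> \<le> emeasure lebesgue (S \<union> (T - S))"
  proof (rule emeasure_mono)
    show "(\<Union>n. A n) \<subseteq> S \<union> (T - S)" using C(2) by (fastforce simp: A_def K_def)
    show "S \<union> (T - S) \<in> sets lebesgue" using S T(3) by (intro sets.Un) auto
  qed
  also have "\<dots> \<le> emeasure lebesgue S + emeasure lebesgue (T - S)"
    using S T(3) by (intro emeasure_subadditive) auto
  also have "\<dots> \<le> emeasure lebesgue S + ennreal e"
    using T(4) by (intro add_left_mono) auto
  finally show "emeasure lebesgue (f ` S) \<le> emeasure lebesgue S + ennreal e" .
qed

text \<open>The inverse of an expanding map is nonexpanding. Boundedness of \<open>B\<close> makes
  its volume finite, which the passage from \<open>emeasure\<close> to the real-valued
  \<open>measure\<close> relies on.\<close>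

lemma measure_le_expanding_image:
  fixes T :: "'a::euclidean_space \<Rightarrow> 'a"
  assumes A: "A \<in> sets borel" and B: "B \<in> sets borel" "bounded B" and T: "T ` A = B"
    and exp: "\<And>x y. x \<in> A \<Longrightarrow> y \<in> A \<Longrightarrow> dist x y \<le> dist (T x) (T y)"
  shows "measure lborel A \<le> measure lborel B"
proof -
  have inj: "inj_on T A" using exp by (fastforce simp: inj_on_def)
  define f where "f = inv_into A T"
  have fB: "f ` B = A" unfolding f_def T[symmetric] using inj by (simp add: inv_into_image_cancel)
  have "emeasure lebesgue (f ` B) \<le> emeasure lebesgue B"
  proof (rule emeasure_nonexpanding_image_le)
    show "B \<in> sets lebesgue" using B by (simp add: lborelD)
    fix x y assume "x \<in> B" "y \<in> B"
    then have "x \<in> T ` A" "y \<in> T ` A" using T by auto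
    then have "f x \<in> A" "f y \<in> A" "T (f x) = x" "T (f y) = y"
      unfolding f_def by (simp_all add: inv_into_into f_inv_into_f)
    then show "dist (f x) (f y) \<le> dist x y"
      using exp[of "f x" "f y"] by simp
  qed
  then have "emeasure lborel A \<le> emeasure lborel B"
    using A B fB by simp
  moreover have "emeasure lborel B < \<infinity>" by (rule emeasure_bounded_finite[OF B(2)])
  ultimately show ?thesis unfolding measure_def by (simp add: enn2real_mono)
qed

section \<open>Local parallel sets and the surface area measure\<close>

text \<open>On a nonempty closed \<open>K\<close> itself the value is 0, so facts about the normal
  concern points outside \<open>K\<close>.\<close>

definition outer_normal :: "'a::euclidean_space set \<Rightarrow> 'a \<Rightarrow> 'a" where
  "outer_normal K x = (x - closest_point K x) /\<^sub>R infdist x K"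

lemma local_parallel_set_eq:
  "local_parallel_set K t E = {x. 0 < infdist x K \<and> infdist x K \<le> t \<and> outer_normal K x \<in> E}"
  by (simp add: local_parallel_set_def outer_normal_def)

section \<open>Nearest points and normal rays\<close>

lemma infdist_closest_point:
  assumes "closed K" "K \<noteq> {}"
  shows "infdist x K = norm (x - closest_point K x)"
  using assms by (simp add: infdist_eq_setdist setdist_closest_point dist_norm)

lemma infdist_pos_iff:
  assumes "closed K" "K \<noteq> {}"
  shows "0 < infdist x K \<longleftrightarrow> x \<notin> K"
  using in_closed_iff_infdist_zero[OF assms, of x] infdist_nonneg[of x K] by auto

lemma outer_normal_props:
  assumes K: "closed K" "convex K" "K \<noteq> {}" and x: "x \<notin> K"
  shows "closest_point K x \<in> K" "norm (outer_normal K x) = 1"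
    "x = closest_point K x + infdist x K *\<^sub>R outer_normal K x"
    "\<And>z. z \<in> K \<Longrightarrow> outer_normal K x \<bullet> (z - closest_point K x) \<le> 0"
proof -
  have pos: "0 < infdist x K" using K x infdist_pos_iff by blast
  show "closest_point K x \<in> K" using K by (intro closest_point_in_set)
  show "norm (outer_normal K x) = 1"
    using pos infdist_closest_point[OF K(1,3), of x] by (simp add: outer_normal_def)
  show "x = closest_point K x + infdist x K *\<^sub>R outer_normal K x"
    using pos by (simp add: outer_normal_def)
  fix z assume "z \<in> K"
  then have "(x - closest_point K x) \<bullet> (z - closest_point K x) \<le> 0"
    using closest_point_dot K by blast
  then show "outer_normal K x \<bullet> (z - closest_point K x) \<le> 0"
    using pos by (simp add: outer_normal_def mult_nonneg_nonpos)
qed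

text \<open>The hyperplane through \<open>p\<close> orthogonal to \<open>u\<close> supports
  \<open>K\<close>, so by Cauchy-Schwarz no point of \<open>K\<close> is closer than
  \<open>r\<close> to the point at height \<open>r\<close> above \<open>p\<close>. Moving along the
  ray therefore changes the distance alone and keeps foot and normal.\<close>

lemma normal_ray:
  assumes K: "closed K" "convex K" and p: "p \<in> K" and u: "norm u = 1"
    and dot: "\<And>z. z \<in> K \<Longrightarrow> u \<bullet> (z - p) \<le> 0" and r: "0 < r"
  shows "closest_point K (p + r *\<^sub>R u) = p" "infdist (p + r *\<^sub>R u) K = r"
    "outer_normal K (p + r *\<^sub>R u) = u"
proof -
  have "p = closest_point K (p + r *\<^sub>R u)"
  proof (rule closest_point_unique[OF K(2,1) p], intro ballI)
    fix z assume z: "z \<in> K"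
    have "r = u \<bullet> (r *\<^sub>R u)" using u by (simp add: dot_square_norm)
    also have "\<dots> \<le> u \<bullet> (p + r *\<^sub>R u - z)"
      using dot[OF z] by (simp add: inner_simps)
    also have "\<dots> \<le> norm u * norm (p + r *\<^sub>R u - z)" by (rule norm_cauchy_schwarz)
    finally show "dist (p + r *\<^sub>R u) p \<le> dist (p + r *\<^sub>R u) z"
      using u r by (simp add: dist_norm)
  qed
  then show 1: "closest_point K (p + r *\<^sub>R u) = p" by simp
  have "K \<noteq> {}" using p by auto
  show 2: "infdist (p + r *\<^sub>R u) K = r"
    using infdist_closest_point[OF K(1) \<open>K \<noteq> {}\<close>] 1 u r by simp
  show "outer_normal K (p + r *\<^sub>R u) = u"
    unfolding outer_normal_def 1 2 using r by simp
qed

lemma continuous_on_outer_normal: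
  assumes "closed K" "convex K" "K \<noteq> {}"
  shows "continuous_on (- K) (outer_normal K)"
proof -
  have "\<forall>x\<in>- K. infdist x K \<noteq> 0" using infdist_pos_iff[OF assms(1,3)] by force
  then show ?thesis unfolding outer_normal_def using assms
    by (intro continuous_intros continuous_on_closest_point) auto
qed

text \<open>Monotonicity of the normal: write both points as foot plus distance times normal. Each
  normal makes a nonpositive inner product with the vector from its own foot to the other foot, and
  the remaining term \<open>(a + b) * (1 - u \<bullet> v)\<close> is nonnegative. Expanding the
  squared distance after the shift then adds only nonnegative terms.\<close>

lemma shift_outer_normal_expanding:
  assumes K: "closed K" "convex K" "K \<noteq> {}" and x: "x \<notin> K" and y: "y \<notin> K" and h: "0 \<le> h"
  shows "dist x y \<le> dist (x + h *\<^sub>R outer_normal K x) (y + h *\<^sub>R outer_normal K y)"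
proof -
  define u v p q a b where defs: "u = outer_normal K x" "v = outer_normal K y"
    "p = closest_point K x" "q = closest_point K y" "a = infdist x K" "b = infdist y K"
  note px = outer_normal_props[OF K x, folded defs] and py = outer_normal_props[OF K y, folded defs]
  have "a \<ge> 0" "b \<ge> 0" by (simp_all add: defs infdist_nonneg)
  have uv: "u \<bullet> v \<le> 1" using norm_cauchy_schwarz[of u v] px py by simp
  have uu: "u \<bullet> u = 1" "v \<bullet> v = 1" using px py by (simp_all add: dot_square_norm)
  have "(u - v) \<bullet> (x - y) = (u - v) \<bullet> ((p + a *\<^sub>R u) - (q + b *\<^sub>R v))"
    using px(3) py(3) by simp
  also have "\<dots> = - (u \<bullet> (q - p)) - v \<bullet> (p - q) + (a + b) * (1 - u \<bullet> v)"
    using uu by (simp add: inner_simps inner_commute algebra_simps)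
  also have "\<dots> \<ge> 0"
    using px(4)[OF py(1)] py(4)[OF px(1)] uv \<open>a \<ge> 0\<close> \<open>b \<ge> 0\<close> by (simp add: mult_nonneg_nonneg)
  finally have mono: "(u - v) \<bullet> (x - y) \<ge> 0" .
  have "(norm ((x + h *\<^sub>R u) - (y + h *\<^sub>R v)))\<^sup>2 = (norm (x - y))\<^sup>2 + 2 * h * ((u - v) \<bullet> (x - y)) + h\<^sup>2 * (norm (u - v))\<^sup>2"
    unfolding power2_norm_eq_inner by (simp add: inner_simps inner_commute algebra_simps power2_eq_square)
  also have "\<dots> \<ge> (norm (x - y))\<^sup>2"
    using mono h by simp
  finally show ?thesis
    unfolding dist_norm defs by (rule power2_le_imp_le) simp
qed

text \<open>By \<open>normal_ray\<close> the shift adds \<open>h\<close> to the distance and keeps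
  the normal. For surjectivity one moves back by \<open>h\<close>; \<open>0 \<le> r1\<close>
  guarantees that the resulting point is still outside \<open>K\<close>.\<close>

lemma shift_outer_normal_image:
  assumes K: "closed K" "convex K" "K \<noteq> {}" and h: "0 \<le> h" and r: "0 \<le> r1"
  shows "(\<lambda>x. x + h *\<^sub>R outer_normal K x) ` {x. r1 < infdist x K \<and> infdist x K \<le> r2 \<and> outer_normal K x \<in> E}
     = {x. r1 + h < infdist x K \<and> infdist x K \<le> r2 + h \<and> outer_normal K x \<in> E}" (is "?T ` ?A = ?B")
proof (intro equalityI subsetI)
  fix y assume "y \<in> ?T ` ?A"
  then obtain x where x: "x \<in> ?A" "y = ?T x" by blast
  then have pos: "0 < infdist x K" using r by simp
  then have "x \<notin> K" using infdist_pos_iff K by blast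
  note px = outer_normal_props[OF K this]
  have "y = closest_point K x + (infdist x K + h) *\<^sub>R outer_normal K x"
    using px(3) x(2) by (simp add: algebra_simps)
  then show "y \<in> ?B"
    using normal_ray[OF K(1,2) px(1,2,4), of "infdist x K + h"] pos h x(1) by simp
next
  fix y assume y: "y \<in> ?B"
  then have pos: "0 < infdist y K" "0 < infdist y K - h" using r h by auto
  then have "y \<notin> K" using infdist_pos_iff K by blast
  note py = outer_normal_props[OF K this]
  let ?x = "closest_point K y + (infdist y K - h) *\<^sub>R outer_normal K y"
  note px = normal_ray[OF K(1,2) py(1,2,4) pos(2)]
  have "?T ?x = ?x + h *\<^sub>R outer_normal K y" by (simp only: px(3))
  also have "\<dots> = closest_point K y + infdist y K *\<^sub>R outer_normal K y"
    by (simp add: algebra_simps)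
  finally have "?T ?x = y" using py(3) by metis
  moreover have "?x \<in> ?A" using px y by simp
  ultimately show "y \<in> ?T ` ?A" by force
qed

lemma borel_outer_normal_vimage:
  assumes K: "closed K" "convex K" "K \<noteq> {}" and E: "E \<in> sets borel" and r: "0 \<le> r"
  shows "{x. r < infdist x K \<and> infdist x K \<le> s \<and> outer_normal K x \<in> E} \<in> sets borel"
proof -
  have "outer_normal K \<in> borel_measurable (restrict_space borel (- K))"
    using K by (intro borel_measurable_continuous_on_restrict continuous_on_outer_normal)
  then have "outer_normal K -` E \<inter> space (restrict_space borel (- K)) \<in> sets (restrict_space borel (- K))"
    using E by (rule measurable_sets)
  then have *: "outer_normal K -` E \<inter> - K \<in> sets borel"
    using K by (auto simp: sets_restrict_space_iff space_restrict_space)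
  have "{x. r < infdist x K} \<in> sets borel" "{x. infdist x K \<le> s} \<in> sets borel"
    by (intro borel_open open_Collect_less borel_closed closed_Collect_le continuous_intros)+
  with * have "{x. r < infdist x K} \<inter> {x. infdist x K \<le> s} \<inter> (outer_normal K -` E \<inter> - K) \<in> sets borel"
    by blast
  also have "{x. r < infdist x K} \<inter> {x. infdist x K \<le> s} \<inter> (outer_normal K -` E \<inter> - K) =
      {x. r < infdist x K \<and> infdist x K \<le> s \<and> outer_normal K x \<in> E}"
    using r infdist_pos_iff[OF K(1,3)] by force
  finally show ?thesis .
qed

lemma bounded_infdist_le:
  fixes K :: "'a::real_normed_vector set"
  assumes "bounded K" "K \<noteq> {}"
  shows "bounded {x. infdist x K \<le> s}"
proof -
  obtain B where B: "\<And>x. x \<in> K \<Longrightarrow> norm x \<le> B" using assms bounded_iff by metis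
  have "norm x \<le> B + s + 1" if x: "infdist x K \<le> s" for x
  proof -
    have "infdist x K < s + 1" using x by simp
    then obtain y where "y \<in> K" "dist x y < s + 1"
      using assms by (auto simp: infdist_notempty cINF_less_iff)
    then show ?thesis using B[of y] norm_triangle_ineq2[of x y] by (simp add: dist_norm)
  qed
  then show ?thesis unfolding bounded_iff by blast
qed

section \<open>Volume of local parallel sets as a function of the distance\<close>

lemma local_parallel_set_lmeasurable:
  assumes "compact K" "convex K" "K \<noteq> {}" "E \<in> sets borel"
  shows "local_parallel_set K t E \<in> fmeasurable lborel"
proof (rule fmeasurableI)
  show "local_parallel_set K t E \<in> sets lborel"
    unfolding local_parallel_set_eq using borel_outer_normal_vimage[of K E 0 t] assms by (simp add: compact_imp_closed)
  show "emeasure lborel (local_parallel_set K t E) < \<infinity>"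
    by (rule emeasure_bounded_finite, rule bounded_subset[OF bounded_infdist_le[of K t]])
      (use assms in \<open>auto simp: local_parallel_set_eq compact_imp_bounded\<close>)
qed

text \<open>Each difference is the volume of a half-open shell with normals in \<open>E\<close>, and
  the outward shift maps the inner shell expansively onto the outer one.\<close>

lemma local_parallel_increments:
  assumes K: "compact K" "convex K" "K \<noteq> {}" "E \<in> sets borel" and r: "0 \<le> r1" "r1 \<le> r2" and h: "0 \<le> h"
  shows "measure lborel (local_parallel_set K r2 E) - measure lborel (local_parallel_set K r1 E) \<le>
    measure lborel (local_parallel_set K (r2 + h) E) - measure lborel (local_parallel_set K (r1 + h) E)"
proof -
  have cl: "closed K" using K by (simp add: compact_imp_closed)
  have incr: "measure lborel (local_parallel_set K s2 E) - measure lborel (local_parallel_set K s1 E) =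
     measure lborel {x. s1 < infdist x K \<and> infdist x K \<le> s2 \<and> outer_normal K x \<in> E}" if "0 \<le> s1" "s1 \<le> s2" for s1 s2
  proof -
    have "{x. s1 < infdist x K \<and> infdist x K \<le> s2 \<and> outer_normal K x \<in> E} =
        local_parallel_set K s2 E - local_parallel_set K s1 E"
      using that by (auto simp: local_parallel_set_eq)
    also have "measure lborel \<dots> = measure lborel (local_parallel_set K s2 E) - measure lborel (local_parallel_set K s1 E)"
    proof (rule measurable_measure_Diff)
      show "local_parallel_set K s2 E \<in> fmeasurable lborel" "local_parallel_set K s1 E \<in> sets lborel"
        using local_parallel_set_lmeasurable[OF K] by (auto simp del: sets_lborel dest: fmeasurableD)
    qed (use that in \<open>auto simp: local_parallel_set_eq\<close>)
    finally show ?thesis by simp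
  qed
  have "measure lborel {x. r1 < infdist x K \<and> infdist x K \<le> r2 \<and> outer_normal K x \<in> E} \<le>
     measure lborel {x. r1 + h < infdist x K \<and> infdist x K \<le> r2 + h \<and> outer_normal K x \<in> E}" (is "measure _ ?A \<le> measure _ ?B")
  proof (rule measure_le_expanding_image)
    show "?A \<in> sets borel" "?B \<in> sets borel"
      using borel_outer_normal_vimage[OF cl K(2-4)] r h by auto
    show "bounded ?B"
      by (rule bounded_subset[OF bounded_infdist_le[of K "r2 + h"]]) (use K in \<open>auto simp: compact_imp_bounded\<close>)
    show "(\<lambda>x. x + h *\<^sub>R outer_normal K x) ` ?A = ?B"
      by (rule shift_outer_normal_image[OF cl K(2,3) h r(1)])
    fix x y assume "x \<in> ?A" "y \<in> ?A"
    then have "0 < infdist x K" "0 < infdist y K" using r by auto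
    then have "x \<notin> K" "y \<notin> K" by (simp_all add: infdist_pos_iff[OF cl K(3)])
    then show "dist x y \<le> dist (x + h *\<^sub>R outer_normal K x) (y + h *\<^sub>R outer_normal K y)"
      using shift_outer_normal_expanding[OF cl K(2,3) _ _ h] by blast
  qed
  then show ?thesis using incr[of r1 r2] incr[of "r1 + h" "r2 + h"] r h by simp
qed

text \<open>Such an \<open>m\<close> is convex with value 0 at 0. The inequality is first proved on
  equally spaced points and then transferred to an arbitrary ratio \<open>s / t\<close>, with
  monotonicity of \<open>m\<close> doing the work of continuity.\<close>

lemma chord_slope_mono_if_increments_mono:
  fixes m :: "real \<Rightarrow> real"
  assumes zero: "m 0 = 0" and mono: "\<And>s t. 0 \<le> s \<Longrightarrow> s \<le> t \<Longrightarrow> m s \<le> m t"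
    and incr: "\<And>r s h. 0 \<le> r \<Longrightarrow> r \<le> s \<Longrightarrow> 0 \<le> h \<Longrightarrow> m s - m r \<le> m (s + h) - m (r + h)"
    and s: "0 < s" "s \<le> t"
  shows "m s / s \<le> m t / t"
proof -
  have grid: "real n * m (real j * \<delta>) \<le> real j * m (real n * \<delta>)" if "j \<le> n" "0 \<le> \<delta>" for j n \<delta>
    using \<open>j \<le> n\<close>
  proof (induction n rule: dec_induct)
    case (step n)
    \<comment> \<open>\<open>d\<close> is the last increment and the largest one, so
      \<open>m\<close> at the \<open>j\<close>-th grid point is at most \<open>j * d\<close>; adding
      this to the induction hypothesis gives the next case.\<close>
    define d where "d = m (real (Suc n) * \<delta>) - m (real n * \<delta>)"
    have "m (real i * \<delta>) \<le> real i * d" if "i \<le> n" for i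
      using that
    proof (induction i)
      case (Suc i)
      have "m (real (Suc i) * \<delta>) - m (real i * \<delta>) \<le> m (real (Suc i) * \<delta> + real (n - i) * \<delta>) - m (real i * \<delta> + real (n - i) * \<delta>)"
        using \<open>0 \<le> \<delta>\<close> by (intro incr) (auto simp: mult_right_mono)
      also have "\<dots> = d"
      proof -
        have "real (Suc i) * \<delta> + real (n - i) * \<delta> = real (Suc n) * \<delta>" "real i * \<delta> + real (n - i) * \<delta> = real n * \<delta>"
          using Suc.prems by (simp_all add: of_nat_diff algebra_simps)
        then show ?thesis by (simp add: d_def)
      qed
      finally show ?case using Suc by (simp add: algebra_simps)
    qed (simp add: zero)
    from this[OF step(1)] have "m (real j * \<delta>) \<le> real j * d" .
    with step.IH show ?case by (simp add: d_def algebra_simps)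
  qed simp
  define \<theta> where "\<theta> = s / t"
  have \<theta>: "0 < \<theta>" "\<theta> \<le> 1" "s = \<theta> * t" "0 < t" using s by (auto simp: \<theta>_def)
  have mt: "0 \<le> m t" using mono[of 0 t] zero \<theta> by simp
  have bound: "m s \<le> \<theta> * m t + m t * inverse (real (Suc n))" for n
  proof -
    define N where "N = real (Suc n)"
    have N: "0 < N" by (simp add: N_def)
    \<comment> \<open>Rounding \<open>\<theta> * N\<close> up keeps the grid point
      \<open>j * t / N\<close> at or above \<open>s\<close>, and costs at most
      \<open>m t / N\<close> in the bound.\<close>
    define j where "j = nat \<lceil>\<theta> * N\<rceil>"
    have "0 \<le> \<lceil>\<theta> * N\<rceil>" using \<theta> N by (simp add: order.strict_implies_order less_le_trans[of "-1" 0])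
    then have rj: "real j = of_int \<lceil>\<theta> * N\<rceil>" by (simp add: j_def)
    have j: "\<theta> * N \<le> real j" "real j \<le> \<theta> * N + 1"
      unfolding rj by linarith+
    have "\<theta> * N \<le> N" using \<theta> N by simp
    then have "\<lceil>\<theta> * N\<rceil> \<le> int (Suc n)" unfolding ceiling_le_iff N_def by simp
    then have "j \<le> Suc n" unfolding j_def by linarith
    then have "N * m (real j * (t / N)) \<le> real j * m (N * (t / N))"
      unfolding N_def using \<theta> by (intro grid) auto
    then have 1: "N * m (real j * (t / N)) \<le> real j * m t"
      using N by simp
    have "m s \<le> m (real j * (t / N))"
    proof (rule mono)
      have "\<theta> * N * t \<le> real j * t" using j(1) \<theta> by (simp add: mult_right_mono)
      then show "s \<le> real j * (t / N)" using N \<theta>(3) by (simp add: field_simps)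
    qed (use s in auto)
    then have "N * m s \<le> N * m (real j * (t / N))"
      using N by simp
    also note 1
    also have "real j * m t \<le> (\<theta> * N + 1) * m t"
      using j mt by (intro mult_right_mono)
    also have "(\<theta> * N + 1) * m t = N * (\<theta> * m t + m t * inverse N)"
      using N by (simp add: field_simps)
    finally have "N * m s \<le> N * (\<theta> * m t + m t * inverse N)" .
    then show ?thesis using N unfolding N_def by (rule mult_left_le_imp_le)
  qed
  have "(\<lambda>n. \<theta> * m t + m t * inverse (real (Suc n))) \<longlonglongrightarrow> \<theta> * m t + m t * 0"
    by (intro tendsto_intros LIMSEQ_inverse_real_of_nat)
  then have "m s \<le> \<theta> * m t + m t * 0"
    by (rule LIMSEQ_le_const) (use bound in blast)
  then show ?thesis using \<theta> by (simp add: field_simps)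
qed

lemma local_parallel_quotient_mono:
  assumes K: "compact K" "convex K" "K \<noteq> {}" "E \<in> sets borel" and s: "0 < s" "s \<le> t"
  shows "measure lborel (local_parallel_set K s E) / s \<le> measure lborel (local_parallel_set K t E) / t"
proof (rule chord_slope_mono_if_increments_mono[OF _ _ _ s])
  show "measure lborel (local_parallel_set K 0 E) = 0"
  proof -
    have "local_parallel_set K 0 E = {}" by (auto simp: local_parallel_set_eq)
    then show ?thesis by simp
  qed
  show "measure lborel (local_parallel_set K r E) \<le> measure lborel (local_parallel_set K s E)" if "r \<le> s" for r s
  proof (rule measure_mono_fmeasurable)
    show "local_parallel_set K r E \<in> sets lborel" "local_parallel_set K s E \<in> fmeasurable lborel"
      using local_parallel_set_lmeasurable[OF K] by (auto simp del: sets_lborel dest: fmeasurableD)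
  qed (use that in \<open>auto simp: local_parallel_set_eq\<close>)
qed (use local_parallel_increments[OF K] in auto)

lemma tendsto_at_right_0_INF_if_mono:
  fixes q :: "real \<Rightarrow> real"
  assumes mono: "\<And>s t. 0 < s \<Longrightarrow> s \<le> t \<Longrightarrow> q s \<le> q t" and nonneg: "\<And>t. 0 < t \<Longrightarrow> 0 \<le> q t"
  shows "(q \<longlongrightarrow> (INF t\<in>{0<..}. q t)) (at_right 0)"
proof (rule order_tendstoI)
  have bdd: "bdd_below (q ` {0<..})" using nonneg by (auto intro!: bdd_belowI[of _ 0])
  fix a
  {
    assume "a < (INF t\<in>{0<..}. q t)"
    then have "a < q t" if "0 < t" for t
      using cINF_lower[OF bdd, of t] that by auto
    then show "eventually (\<lambda>t. a < q t) (at_right 0)"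
      unfolding eventually_at_right_field by (intro exI[of _ 1]) auto
  }
  assume "(INF t\<in>{0<..}. q t) < a"
  then obtain t0 where "0 < t0" "q t0 < a"
    using cINF_less_iff[OF _ bdd, of a] by auto
  then have "q t < a" if "0 < t" "t < t0" for t
    using mono[of t t0] that by simp
  with \<open>0 < t0\<close> show "eventually (\<lambda>t. q t < a) (at_right 0)"
    unfolding eventually_at_right_field by blast
qed

section \<open>The surface area measure as an infimum of volume quotients\<close>

lemma sets_surface_area_measure [measurable_cong]:
  "sets (surface_area_measure (K :: 'a::euclidean_space set)) = sets (restrict_space borel (sphere 0 1))"
  unfolding surface_area_measure_def
  using sets.sets_measure_of_eq[of "restrict_space borel (sphere (0::'a) 1)"] by (simp add: space_restrict_space)

lemma space_surface_area_measure: "space (surface_area_measure K) = sphere 0 1"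
  using sets_eq_imp_space_eq[OF sets_surface_area_measure, of K] by (simp add: space_restrict_space)

lemma borel_sphere_subsets: "E \<in> sets (restrict_space borel (sphere (0::'a::euclidean_space) 1)) \<Longrightarrow> E \<in> sets borel"
  by (subst (asm) sets_restrict_space_iff) auto

text \<open>This rules out the null measure that \<open>measure_of\<close> returns by default. For
  fixed \<open>t\<close> the quotient is countably additive in the set; as \<open>t\<close>
  decreases to 0 it decreases, and a decreasing limit may be exchanged with the sum once one of the
  sums is finite.\<close>

lemma emeasure_surface_area_measure:
  assumes K: "compact K" "convex K" "K \<noteq> {}" and E: "E \<in> sets (surface_area_measure K)"
  shows "emeasure (surface_area_measure K) E =
      ennreal (INF t\<in>{0<..}. measure lborel (local_parallel_set K t E) / t)"
proof -
  let ?\<B> = "sets (restrict_space borel (sphere (0::'a) 1))"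
  define s where "s E = (INF t\<in>{0<..}. measure lborel (local_parallel_set K t E) / t)" for E
  define q where "q t E = emeasure lborel (local_parallel_set K t E) / ennreal t" for t E
  have q_eq: "q t E = ennreal (measure lborel (local_parallel_set K t E) / t)" if "E \<in> ?\<B>" "0 < t" for t E
  proof -
    have "emeasure lborel (local_parallel_set K t E) = ennreal (measure lborel (local_parallel_set K t E))"
      using local_parallel_set_lmeasurable[OF K borel_sphere_subsets[OF that(1)]]
      by (intro emeasure_eq_measure2)
    then show ?thesis using that by (simp add: q_def divide_ennreal)
  qed
  have mono: "q u E \<le> q t E" if "E \<in> ?\<B>" "0 < u" "u \<le> t" for u t E
    using local_parallel_quotient_mono[OF K borel_sphere_subsets[OF that(1)] that(2,3)] that
    by (simp add: q_eq ennreal_leI)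
  have lim: "((\<lambda>t. q t E) \<longlongrightarrow> ennreal (s E)) (at_right 0)" if "E \<in> ?\<B>" for E
  proof (rule Lim_transform_eventually)
    show "((\<lambda>t. ennreal (measure lborel (local_parallel_set K t E) / t)) \<longlongrightarrow> ennreal (s E)) (at_right 0)"
      unfolding s_def using local_parallel_quotient_mono[OF K borel_sphere_subsets[OF that]]
      by (intro tendsto_ennrealI tendsto_at_right_0_INF_if_mono) auto
    show "\<forall>\<^sub>F t in at_right 0. ennreal (measure lborel (local_parallel_set K t E) / t) = q t E"
      using q_eq[OF that] by (auto simp: eventually_at_right_field intro!: exI[of _ 1])
  qed
  have Lim: "Lim (at_right 0) (\<lambda>t. q t E) = ennreal (s E)" if "E \<in> ?\<B>" for E
    using lim[OF that] by (intro tendsto_Lim) auto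
  \<comment> \<open>A sequence of scales turns the one-sided limit into a countable infimum, as
    monotone convergence requires.\<close>
  define r where "r = (\<lambda>j. inverse (real (Suc j)))"
  have r: "0 < r j" "r (Suc j) \<le> r j" for j by (auto simp: r_def field_simps)
  have s_INF: "ennreal (s E) = (INF j. q (r j) E)" if "E \<in> ?\<B>" for E
  proof (rule LIMSEQ_unique)
    show "(\<lambda>j. q (r j) E) \<longlonglongrightarrow> ennreal (s E)"
      by (rule filterlim_compose[OF lim[OF that]])
        (use r(1) LIMSEQ_inverse_real_of_nat in \<open>auto simp: filterlim_at r_def\<close>)
    show "(\<lambda>j. q (r j) E) \<longlonglongrightarrow> (INF j. q (r j) E)"
      by (intro LIMSEQ_INF decseq_SucI mono that r)
  qed
  have q_add: "(\<Sum>i. q t (A i)) = q t (\<Union>i. A i)" if A: "range A \<subseteq> ?\<B>" "disjoint_family A" for A t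
  proof -
    have "(\<Sum>i. emeasure lborel (local_parallel_set K t (A i))) = emeasure lborel (\<Union>i. local_parallel_set K t (A i))"
    proof (rule suminf_emeasure)
      show "range (\<lambda>i. local_parallel_set K t (A i)) \<subseteq> sets lborel"
        using local_parallel_set_lmeasurable[OF K borel_sphere_subsets] A(1) by blast
      show "disjoint_family (\<lambda>i. local_parallel_set K t (A i))"
        using A(2) unfolding disjoint_family_on_def local_parallel_set_eq by blast
    qed
    also have "(\<Union>i. local_parallel_set K t (A i)) = local_parallel_set K t (\<Union>i. A i)"
      unfolding local_parallel_set_eq by blast
    finally show ?thesis unfolding q_def ennreal_suminf_divide by simp
  qed
  have add: "(\<Sum>i. ennreal (s (A i))) = ennreal (s (\<Union>i. A i))" if A: "range A \<subseteq> ?\<B>" "disjoint_family A" for A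
  proof -
    have AB: "A i \<in> ?\<B>" for i using A by auto
    have UB: "(\<Union>i. A i) \<in> ?\<B>" using A(1) by (intro sets.countable_UN) auto
    \<comment> \<open>The series is read as an integral over counting measure; finiteness at scale
      \<open>r 0\<close> is finiteness of the quotient of the union.\<close>
    have "(\<Sum>i. ennreal (s (A i))) = (\<integral>\<^sup>+i. (INF j. q (r j) (A i)) \<partial>count_space UNIV)"
      by (simp add: s_INF[OF AB] nn_integral_count_space_nat)
    also have "\<dots> = (INF j. \<integral>\<^sup>+i. q (r j) (A i) \<partial>count_space UNIV)"
    proof (subst nn_integral_monotone_convergence_INF_decseq[where i=0])
      show "decseq (\<lambda>j i. q (r j) (A i))"
        by (intro decseq_SucI le_funI mono AB r)
      show "(\<integral>\<^sup>+i. q (r 0) (A i) \<partial>count_space UNIV) < \<infinity>"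
        unfolding nn_integral_count_space_nat q_add[OF A] by (simp add: q_eq[OF UB r(1)])
    qed auto
    also have "\<dots> = (INF j. q (r j) (\<Union>i. A i))"
      by (simp add: nn_integral_count_space_nat q_add[OF A])
    also have "\<dots> = ennreal (s (\<Union>i. A i))"
      using s_INF[OF UB] by simp
    finally show ?thesis .
  qed
  have s_empty: "s {} = 0"
    by (simp add: s_def local_parallel_set_eq)
  show ?thesis
    unfolding s_def[symmetric]
  proof (subst emeasure_measure_of[OF surface_area_measure_def])
    show "?\<B> \<subseteq> Pow (sphere 0 1)"
      using sets.space_closed[of "restrict_space borel (sphere (0::'a) 1)"] by (simp add: space_restrict_space)
    show "positive (sets (surface_area_measure K)) (\<lambda>E. Lim (at_right 0) (\<lambda>t. emeasure lborel (local_parallel_set K t E) / ennreal t))"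
      unfolding positive_def q_def[symmetric] by (simp add: Lim s_empty)
    show "countably_additive (sets (surface_area_measure K)) (\<lambda>E. Lim (at_right 0) (\<lambda>t. emeasure lborel (local_parallel_set K t E) / ennreal t))"
      unfolding countably_additive_def q_def[symmetric] sets_surface_area_measure
      using add by (auto simp: Lim subset_iff)
    show "E \<in> sets (surface_area_measure K)" by (rule E)
    show "Lim (at_right 0) (\<lambda>t. emeasure lborel (local_parallel_set K t E) / ennreal t) = ennreal (s E)"
      using Lim E unfolding q_def[symmetric] sets_surface_area_measure by blast
  qed
qed

lemma finite_measure_surface_area_measure:
  assumes "compact K" "convex K" "K \<noteq> {}"
  shows "finite_measure (surface_area_measure K)"
  by (rule finite_measureI) (simp add: emeasure_surface_area_measure[OF assms sets.top])

lemma measure_surface_area_measure: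
  assumes K: "compact K" "convex K" "K \<noteq> {}" and E: "E \<in> sets (surface_area_measure K)"
  shows "measure (surface_area_measure K) E = (INF t\<in>{0<..}. measure lborel (local_parallel_set K t E) / t)"
proof -
  have "0 \<le> (INF t\<in>{0<..}. measure lborel (local_parallel_set K t E) / t)"
    by (intro cINF_greatest) auto
  then show ?thesis
    unfolding measure_def emeasure_surface_area_measure[OF K E] by simp
qed

lemma local_parallel_quotient_tendsto:
  assumes K: "compact K" "convex K" "K \<noteq> {}" and E: "E \<in> sets (surface_area_measure K)"
  shows "((\<lambda>t. measure lborel (local_parallel_set K t E) / t) \<longlongrightarrow> measure (surface_area_measure K) E) (at_right 0)"
  unfolding measure_surface_area_measure[OF K E]
  using local_parallel_quotient_mono[OF K borel_sphere_subsets[OF E[unfolded sets_surface_area_measure]]]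
  by (intro tendsto_at_right_0_INF_if_mono) auto

text \<open>An infimum is a bound at every scale, not merely in the limit. The lower volume bound
  uses this at the moving scale \<open>e i * c\<close>, free of any error term.\<close>

lemma surface_area_measure_le_local_parallel_quotient:
  assumes K: "compact K" "convex K" "K \<noteq> {}" and E: "E \<in> sets (surface_area_measure K)" and t: "0 < t"
  shows "measure (surface_area_measure K) E * t \<le> measure lborel (local_parallel_set K t E)"
proof -
  have "measure (surface_area_measure K) E \<le> measure lborel (local_parallel_set K t E) / t"
    unfolding measure_surface_area_measure[OF K E]
    by (rule cINF_lower) (use t in \<open>auto intro!: bdd_belowI[of _ 0]\<close>)
  then show ?thesis using t by (simp add: field_simps)
qed

section \<open>First variation of volume\<close>

text \<open>A layer over \<open>K\<close> of thickness \<open>s * k u\<close> in direction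
  \<open>u\<close>; for constant \<open>k\<close> it is a local parallel set over all directions.
  Its volume divided by \<open>s\<close> is to be compared with the integral of \<open>k\<close>
  against the surface area measure.\<close>

definition outer_region :: "'a::euclidean_space set \<Rightarrow> ('a \<Rightarrow> real) \<Rightarrow> real \<Rightarrow> 'a set" where
  "outer_region K k s = {x. 0 < infdist x K \<and> infdist x K \<le> s * k (outer_normal K x)}"

lemma outer_normal_in_sphere:
  assumes "closed K" "convex K" "K \<noteq> {}" "x \<notin> K"
  shows "outer_normal K x \<in> sphere 0 1"
  using outer_normal_props(2)[OF assms] by simp

lemma continuous_on_sphere_bounded:
  fixes k :: "'a::euclidean_space \<Rightarrow> real"
  assumes "continuous_on (sphere 0 1) k"
  obtains B where "0 < B" "\<And>u. u \<in> sphere 0 1 \<Longrightarrow> \<bar>k u\<bar> \<le> B"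
proof -
  have "bounded (k ` sphere 0 1)"
    using assms by (intro compact_imp_bounded compact_continuous_image) auto
  then show ?thesis using that unfolding bounded_pos by auto
qed

lemma borel_measurable_surface_area_measure:
  fixes k :: "'a::euclidean_space \<Rightarrow> real"
  assumes "continuous_on (sphere 0 1) k"
  shows "k \<in> borel_measurable (surface_area_measure K)"
proof -
  have "k \<in> borel_measurable (restrict_space borel (sphere 0 1))"
    by (rule borel_measurable_continuous_on_restrict[OF assms])
  then show ?thesis using measurable_cong_sets[OF sets_surface_area_measure refl] by blast
qed

lemma integrable_surface_area_measure:
  fixes k :: "'a::euclidean_space \<Rightarrow> real"
  assumes K: "compact K" "convex K" "K \<noteq> {}" and k: "continuous_on (sphere 0 1) k"
  shows "integrable (surface_area_measure K) k"
proof -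
  interpret finite_measure "surface_area_measure K"
    by (rule finite_measure_surface_area_measure[OF K])
  obtain B where "\<And>u. u \<in> sphere 0 1 \<Longrightarrow> \<bar>k u\<bar> \<le> B"
    using continuous_on_sphere_bounded[OF k] by blast
  then show ?thesis
    by (intro integrable_const_bound[where B=B] borel_measurable_surface_area_measure k AE_I2)
      (simp add: space_surface_area_measure)
qed

lemma outer_region_lmeasurable:
  assumes K: "compact K" "convex K" "K \<noteq> {}" and k: "continuous_on (sphere 0 1) k" and s: "0 \<le> s"
  shows "outer_region K k s \<in> fmeasurable lborel"
proof (rule fmeasurableI)
  have cl: "closed K" using K by (simp add: compact_imp_closed)
  define f where "f = (\<lambda>x. infdist x K - s * k (outer_normal K x))"
  have "continuous_on (- K) f"
    unfolding f_def
    by (intro continuous_intros continuous_on_compose2[OF k continuous_on_outer_normal[OF cl K(2,3)]])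
      (use outer_normal_in_sphere[OF cl K(2,3)] in auto)
  then have "f \<in> borel_measurable (restrict_space borel (- K))"
    by (rule borel_measurable_continuous_on_restrict)
  then have "f -` {..0} \<inter> space (restrict_space borel (- K)) \<in> sets (restrict_space borel (- K))"
    by (rule measurable_sets) simp
  then have "f -` {..0} \<inter> - K \<in> sets borel"
    using cl by (auto simp: sets_restrict_space_iff space_restrict_space)
  also have "f -` {..0} \<inter> - K = outer_region K k s"
    using infdist_pos_iff[OF cl K(3)] by (auto simp: outer_region_def f_def)
  finally show "outer_region K k s \<in> sets lborel" by simp
  obtain B where B: "\<And>u. u \<in> sphere 0 1 \<Longrightarrow> \<bar>k u\<bar> \<le> B"
    using continuous_on_sphere_bounded[OF k] by blast
  have "outer_region K k s \<subseteq> {x. infdist x K \<le> s * B}"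
  proof
    fix x assume x: "x \<in> outer_region K k s"
    then have "x \<notin> K" using infdist_pos_iff[OF cl K(3)] by (auto simp: outer_region_def)
    then have "s * k (outer_normal K x) \<le> s * B"
      using s B[OF outer_normal_in_sphere[OF cl K(2,3)], of x] by (intro mult_left_mono) auto
    then show "x \<in> {x. infdist x K \<le> s * B}" using x by (auto simp: outer_region_def)
  qed
  moreover have "bounded {x. infdist x K \<le> s * B}"
    by (rule bounded_infdist_le[OF compact_imp_bounded[OF K(1)] K(3)])
  ultimately have "bounded (outer_region K k s)" by (rule bounded_subset[rotated])
  then show "emeasure lborel (outer_region K k s) < \<infinity>" by (rule emeasure_bounded_finite)
qed

section \<open>Approximation of the thickness by step functions\<close>

lemma real_level_index:
  fixes v \<delta> :: real
  assumes "0 \<le> v" "v \<le> real N * \<delta>" "0 < \<delta>"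
  obtains j :: nat where "j \<le> N" "(real j - 1) * \<delta> < v" "v \<le> real j * \<delta>"
proof
  define j where "j = nat \<lceil>v / \<delta>\<rceil>"
  have "0 \<le> v / \<delta>" using assms by simp
  then have "0 \<le> \<lceil>v / \<delta>\<rceil>" by linarith
  then have rj: "real j = of_int \<lceil>v / \<delta>\<rceil>" by (simp add: j_def)
  have "real j - 1 < v / \<delta>" "v / \<delta> \<le> real j" unfolding rj by linarith+
  then show "(real j - 1) * \<delta> < v" "v \<le> real j * \<delta>"
    using assms by (simp_all add: field_simps)
  have "v / \<delta> \<le> real N" using assms by (simp add: field_simps)
  then show "j \<le> N" unfolding j_def by linarith
qed

lemma real_level_index_unique:
  fixes v \<delta> :: real
  assumes "(real i - 1) * \<delta> < v" "v \<le> real i * \<delta>" "(real j - 1) * \<delta> < v" "v \<le> real j * \<delta>" "0 < \<delta>"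
  shows "i = j"
proof -
  have "(real i - 1) * \<delta> < real j * \<delta>" "(real j - 1) * \<delta> < real i * \<delta>" using assms by linarith+
  then have "real i - 1 < real j" "real j - 1 < real i" using \<open>0 < \<delta>\<close> by (simp_all add: mult_less_cancel_right)
  then show ?thesis by linarith
qed

text \<open>Bands are open below, and the subtraction is one of reals: band 0 has range
  \<open>(-\<delta>, 0]\<close> and so holds the zeros of a nonnegative \<open>k\<close>. The upper
  end \<open>j * \<delta>\<close> serves as the rounded value of \<open>k\<close>.\<close>

definition level_band :: "('a::euclidean_space \<Rightarrow> real) \<Rightarrow> real \<Rightarrow> nat \<Rightarrow> 'a set" where
  "level_band k \<delta> j = {u \<in> sphere 0 1. (real j - 1) * \<delta> < k u \<and> k u \<le> real j * \<delta>}"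

lemma level_band_sets:
  assumes "continuous_on (sphere 0 1) k"
  shows "level_band k \<delta> j \<in> sets (surface_area_measure K)" "level_band k \<delta> j \<in> sets borel"
proof -
  have "k -` {(real j - 1) * \<delta><..real j * \<delta>} \<inter> space (surface_area_measure K) \<in> sets (surface_area_measure K)"
    by (rule measurable_sets[OF borel_measurable_surface_area_measure[OF assms]]) simp
  also have "k -` {(real j - 1) * \<delta><..real j * \<delta>} \<inter> space (surface_area_measure K) = level_band k \<delta> j"
    by (auto simp: level_band_def space_surface_area_measure)
  finally show 1: "level_band k \<delta> j \<in> sets (surface_area_measure K)" .
  then show "level_band k \<delta> j \<in> sets borel"
    unfolding sets_surface_area_measure by (rule borel_sphere_subsets)
qed

text \<open>Rounding the thickness up to the upper end of its band only enlarges the layer.\<close>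

lemma outer_region_le_bands:
  assumes K: "compact K" "convex K" "K \<noteq> {}" and k: "continuous_on (sphere 0 1) k"
    and kN: "\<And>u. u \<in> sphere 0 1 \<Longrightarrow> 0 \<le> k u \<and> k u \<le> real N * \<delta>" and \<delta>: "0 < \<delta>" and s: "0 < s"
  shows "measure lborel (outer_region K k s) \<le>
      (\<Sum>j\<le>N. measure lborel (local_parallel_set K (s * (real j * \<delta>)) (level_band k \<delta> j)))"
proof -
  have cl: "closed K" using K by (simp add: compact_imp_closed)
  have fm: "local_parallel_set K t (level_band k \<delta> j) \<in> fmeasurable lborel" for t j
    by (rule local_parallel_set_lmeasurable[OF K level_band_sets(2)[OF k]])
  have "outer_region K k s \<subseteq> (\<Union>j\<le>N. local_parallel_set K (s * (real j * \<delta>)) (level_band k \<delta> j))"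
  proof
    fix x assume x: "x \<in> outer_region K k s"
    then have "x \<notin> K" using infdist_pos_iff[OF cl K(3)] by (auto simp: outer_region_def)
    then have u: "outer_normal K x \<in> sphere 0 1" by (rule outer_normal_in_sphere[OF cl K(2,3)])
    obtain j where j: "j \<le> N" "(real j - 1) * \<delta> < k (outer_normal K x)" "k (outer_normal K x) \<le> real j * \<delta>"
      using real_level_index kN[OF u] \<delta> by metis
    have "s * k (outer_normal K x) \<le> s * (real j * \<delta>)" using j s by simp
    then have "x \<in> local_parallel_set K (s * (real j * \<delta>)) (level_band k \<delta> j)"
      using x u j by (auto simp: outer_region_def local_parallel_set_eq level_band_def)
    then show "x \<in> (\<Union>j\<le>N. local_parallel_set K (s * (real j * \<delta>)) (level_band k \<delta> j))" using j by blast
  qed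
  then have "measure lborel (outer_region K k s) \<le> measure lborel (\<Union>j\<le>N. local_parallel_set K (s * (real j * \<delta>)) (level_band k \<delta> j))"
    using fm fmeasurableD[OF outer_region_lmeasurable[OF K k]] s
    by (intro measure_mono_fmeasurable fmeasurable.finite_UN) auto
  also have "\<dots> \<le> (\<Sum>j\<le>N. measure lborel (local_parallel_set K (s * (real j * \<delta>)) (level_band k \<delta> j)))"
    using fm by (intro measure_UNION_le) (auto simp del: sets_lborel dest: fmeasurableD)
  finally show ?thesis .
qed

text \<open>Rounding up adds less than \<open>\<delta>\<close>. The pieces are disjoint because each
  point has one normal and each normal lies in at most one band, so their volumes add up to that of
  a union inside the thicker layer.\<close>

lemma bands_le_outer_region:
  assumes K: "compact K" "convex K" "K \<noteq> {}" and k: "continuous_on (sphere 0 1) k"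
    and \<delta>: "0 < \<delta>" and s: "0 < s"
  shows "(\<Sum>j\<le>N. measure lborel (local_parallel_set K (s * (real j * \<delta>)) (level_band k \<delta> j))) \<le>
    measure lborel (outer_region K (\<lambda>u. k u + \<delta>) s)"
proof -
  define A where "A j = local_parallel_set K (s * (real j * \<delta>)) (level_band k \<delta> j)" for j
  have fm: "A j \<in> fmeasurable lborel" for j
    unfolding A_def by (rule local_parallel_set_lmeasurable[OF K level_band_sets(2)[OF k]])
  have "(\<Sum>j\<le>N. measure lborel (A j)) = measure lborel (\<Union>j\<le>N. A j)"
  proof (rule measure_finite_Union[symmetric])
    show "disjoint_family_on A {..N}"
      unfolding disjoint_family_on_def A_def local_parallel_set_eq level_band_def
      using real_level_index_unique[OF _ _ _ _ \<delta>] by blast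
    show "A ` {..N} \<subseteq> sets lborel" using fm by (auto simp del: sets_lborel dest: fmeasurableD)
    show "emeasure lborel (A i) \<noteq> \<infinity>" if "i \<in> {..N}" for i
      using fmeasurableD2[OF fm[of i]] by simp
  qed simp
  also have "\<dots> \<le> measure lborel (outer_region K (\<lambda>u. k u + \<delta>) s)"
  proof (rule measure_mono_fmeasurable)
    show "(\<Union>j\<le>N. A j) \<subseteq> outer_region K (\<lambda>u. k u + \<delta>) s"
    proof safe
      fix j x assume "x \<in> A j"
      then have x: "0 < infdist x K" "infdist x K \<le> s * (real j * \<delta>)" "(real j - 1) * \<delta> < k (outer_normal K x)"
        by (auto simp: A_def local_parallel_set_eq level_band_def)
      then have "s * (real j * \<delta>) \<le> s * (k (outer_normal K x) + \<delta>)"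
        using s by (intro mult_left_mono) (auto simp: algebra_simps)
      then show "x \<in> outer_region K (\<lambda>u. k u + \<delta>) s" using x by (simp add: outer_region_def)
    qed
    show "(\<Union>j\<le>N. A j) \<in> sets lborel" using fm by (intro sets.finite_UN) (auto simp del: sets_lborel dest: fmeasurableD)
    show "outer_region K (\<lambda>u. k u + \<delta>) s \<in> fmeasurable lborel"
      using s by (intro outer_region_lmeasurable K continuous_intros k) auto
  qed
  finally show ?thesis unfolding A_def .
qed

text \<open>Monotonicity of the quotient is available for constant thickness, hence band by band
  after rounding; \<open>\<delta>\<close> pays for the rounding. As it holds for all
  \<open>s \<le> t\<close>, it can be applied to a varying body whose own surface area measure is
  not under control.\<close>

lemma outer_region_quotient_mono:
  assumes K: "compact K" "convex K" "K \<noteq> {}" and k: "continuous_on (sphere 0 1) k"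
    and k0: "\<And>u. u \<in> sphere 0 1 \<Longrightarrow> 0 \<le> k u" and \<delta>: "0 < \<delta>" and s: "0 < s" "s \<le> t"
  shows "measure lborel (outer_region K k s) \<le> s / t * measure lborel (outer_region K (\<lambda>u. k u + \<delta>) t)"
proof -
  obtain B where B: "0 < B" "\<And>u. u \<in> sphere 0 1 \<Longrightarrow> \<bar>k u\<bar> \<le> B"
    using continuous_on_sphere_bounded[OF k] by blast
  obtain N :: nat where "B / \<delta> \<le> real N" using real_arch_simple by blast
  then have N: "B \<le> real N * \<delta>" using \<delta> by (simp add: field_simps)
  define m where "m r j = measure lborel (local_parallel_set K (r * (real j * \<delta>)) (level_band k \<delta> j))" for r j
  have mm: "m s j \<le> s / t * m t j" for j
  proof (cases "j = 0")
    case True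
    have "local_parallel_set K 0 (level_band k \<delta> j) = {}" by (auto simp: local_parallel_set_eq)
    then show ?thesis using True by (simp add: m_def)
  next
    case False
    then have "0 < s * (real j * \<delta>)" "s * (real j * \<delta>) \<le> t * (real j * \<delta>)" using s \<delta> by auto
    from local_parallel_quotient_mono[OF K level_band_sets(2)[OF k] this]
    show ?thesis using s \<delta> False by (simp add: m_def field_simps)
  qed
  have "measure lborel (outer_region K k s) \<le> (\<Sum>j\<le>N. m s j)"
    unfolding m_def by (rule outer_region_le_bands[OF K k _ \<delta> s(1)]) (use k0 B N in fastforce)
  also have "\<dots> \<le> s / t * (\<Sum>j\<le>N. m t j)"
    unfolding sum_distrib_left by (intro sum_mono mm)
  also have "\<dots> \<le> s / t * measure lborel (outer_region K (\<lambda>u. k u + \<delta>) t)"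
    unfolding m_def using s by (intro mult_left_mono bands_le_outer_region[OF K k \<delta>]) auto
  finally show ?thesis .
qed

lemma local_parallel_scaled_tendsto:
  assumes K: "compact K" "convex K" "K \<noteq> {}" and E: "E \<in> sets (surface_area_measure K)" and c: "0 \<le> c"
  shows "((\<lambda>t. measure lborel (local_parallel_set K (t * c) E) / t) \<longlongrightarrow> c * measure (surface_area_measure K) E) (at_right 0)"
proof (cases "c = 0")
  case True
  have "local_parallel_set K 0 E = {}" by (auto simp: local_parallel_set_eq)
  then show ?thesis using True by simp
next
  case False
  then have c: "0 < c" using c by simp
  have "filterlim (\<lambda>t. t * c) (at_right 0) (at_right 0)"
    unfolding filterlim_at using c
    by (auto intro!: tendsto_eq_intros eventually_at_right_less simp: eventually_at_right_field intro: exI[of _ 1])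
  from tendsto_mult[OF tendsto_const[of c] filterlim_compose[OF local_parallel_quotient_tendsto[OF K E] this]]
  show ?thesis using c by simp
qed

text \<open>For finitely many bands the limits of the local quotients may be summed. They give the
  integral of a step function that exceeds \<open>k\<close> by at most
  \<open>\<delta>\<close>.\<close>

lemma outer_region_eventually_le:
  assumes K: "compact K" "convex K" "K \<noteq> {}" and k: "continuous_on (sphere 0 1) k"
    and k0: "\<And>u. u \<in> sphere 0 1 \<Longrightarrow> 0 \<le> k u" and \<eta>: "0 < \<eta>"
  shows "eventually (\<lambda>t. measure lborel (outer_region K k t) \<le> t * ((\<integral>u. k u \<partial>surface_area_measure K) + \<eta>)) (at_right 0)"
proof -
  let ?S = "surface_area_measure K"
  interpret finite_measure ?S by (rule finite_measure_surface_area_measure[OF K])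
  \<comment> \<open>The summand 1 avoids division by 0 and makes the rounding error
    \<open>\<delta>\<close> times the total mass strictly less than \<open>\<eta>\<close>.\<close>
  define \<delta> where "\<delta> = \<eta> / (measure ?S (space ?S) + 1)"
  have \<delta>: "0 < \<delta>" using \<eta> by (simp add: \<delta>_def add_nonneg_pos)
  have \<delta>S: "\<delta> * measure ?S (space ?S) < \<eta>"
  proof -
    have "measure ?S (space ?S) + 1 \<noteq> 0"
      using measure_nonneg[of ?S "space ?S"] by linarith
    then have "\<delta> * (measure ?S (space ?S) + 1) = \<eta>" unfolding \<delta>_def by simp
    then show ?thesis using \<delta> by (simp add: algebra_simps)
  qed
  obtain B where B: "0 < B" "\<And>u. u \<in> sphere 0 1 \<Longrightarrow> \<bar>k u\<bar> \<le> B"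
    using continuous_on_sphere_bounded[OF k] by blast
  obtain N :: nat where "B / \<delta> \<le> real N" using real_arch_simple by blast
  then have N: "B \<le> real N * \<delta>" using \<delta> by (simp add: field_simps)
  define m where "m r j = measure lborel (local_parallel_set K (r * (real j * \<delta>)) (level_band k \<delta> j))" for r j
  note band = level_band_sets(1)[OF k, of \<delta> _ K]
  have "(\<Sum>j\<le>N. real j * \<delta> * measure ?S (level_band k \<delta> j)) =
      (\<integral>u. (\<Sum>j\<le>N. real j * \<delta> * indicator (level_band k \<delta> j) u) \<partial>?S)"
    using band by (subst Bochner_Integration.integral_sum) (auto simp: less_top[symmetric])
  also have "\<dots> \<le> (\<integral>u. k u + \<delta> \<partial>?S)"
  proof (rule integral_mono)
    show "integrable ?S (\<lambda>u. \<Sum>j\<le>N. real j * \<delta> * indicator (level_band k \<delta> j) u)"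
      using band by (intro Bochner_Integration.integrable_sum integrable_mult_right integrable_real_indicator)
        (auto simp: less_top[symmetric])
    show "integrable ?S (\<lambda>u. k u + \<delta>)"
      by (intro integrable_surface_area_measure K continuous_intros k)
    fix u assume "u \<in> space ?S"
    then have u: "u \<in> sphere 0 1" by (simp add: space_surface_area_measure)
    obtain i where i: "i \<le> N" "(real i - 1) * \<delta> < k u" "k u \<le> real i * \<delta>"
      using real_level_index[of "k u" N \<delta>] k0[OF u] B(2)[OF u] N \<delta> by (metis abs_le_D1 order_trans)
    \<comment> \<open>Exactly one band contains \<open>u\<close>, so the step function at
      \<open>u\<close> is a single rounded value.\<close>
    have "u \<in> level_band k \<delta> j \<longleftrightarrow> j = i" for j
      using real_level_index_unique[OF _ _ i(2,3) \<delta>, of j] u i(2,3) unfolding level_band_def by blast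
    then have "(\<Sum>j\<le>N. real j * \<delta> * indicator (level_band k \<delta> j) u) = (\<Sum>j\<le>N. if j = i then real i * \<delta> else 0)"
      by (intro sum.cong refl) (simp add: indicator_def)
    also have "\<dots> = real i * \<delta>" using i by simp
    also have "\<dots> \<le> k u + \<delta>" using i by (simp add: algebra_simps)
    finally show "(\<Sum>j\<le>N. real j * \<delta> * indicator (level_band k \<delta> j) u) \<le> k u + \<delta>" .
  qed
  also have "\<dots> = (\<integral>u. k u \<partial>?S) + \<delta> * measure ?S (space ?S)"
    using integrable_surface_area_measure[OF K k] by (simp add: mult.commute)
  also have "\<dots> < (\<integral>u. k u \<partial>?S) + \<eta>" using \<delta>S by simp
  finally have lt: "(\<Sum>j\<le>N. real j * \<delta> * measure ?S (level_band k \<delta> j)) < (\<integral>u. k u \<partial>?S) + \<eta>" .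
  have "((\<lambda>t. \<Sum>j\<le>N. m t j / t) \<longlongrightarrow> (\<Sum>j\<le>N. real j * \<delta> * measure ?S (level_band k \<delta> j))) (at_right 0)"
    unfolding m_def using \<delta> by (intro tendsto_sum local_parallel_scaled_tendsto K band) auto
  then have "eventually (\<lambda>t. (\<Sum>j\<le>N. m t j / t) < (\<integral>u. k u \<partial>?S) + \<eta>) (at_right 0)"
    using lt by (rule order_tendstoD(2))
  moreover have "eventually (\<lambda>t::real. 0 < t) (at_right 0)" by (rule eventually_at_right_less)
  ultimately show ?thesis
  proof eventually_elim
    case (elim t)
    have "measure lborel (outer_region K k t) \<le> (\<Sum>j\<le>N. m t j)"
      unfolding m_def by (rule outer_region_le_bands[OF K k _ \<delta>]) (use k0 B N elim in fastforce)+
    also have "\<dots> = t * (\<Sum>j\<le>N. m t j / t)"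
      using elim by (simp add: sum_distrib_left)
    also have "\<dots> \<le> t * ((\<integral>u. k u \<partial>?S) + \<eta>)" using elim by (intro mult_left_mono) auto
    finally show ?case .
  qed
qed

section \<open>Support functions, nearest points and their stability\<close>

lemma support_function_ge:
  assumes "compact K" "y \<in> K"
  shows "x \<bullet> y \<le> support_function K x"
proof -
  have "compact ((\<lambda>y. x \<bullet> y) ` K)"
    by (intro compact_continuous_image continuous_intros assms)
  then have "bdd_above ((\<lambda>y. x \<bullet> y) ` K)" by (intro bounded_imp_bdd_above compact_imp_bounded)
  then show ?thesis unfolding support_function_def using assms by (intro cSUP_upper)
qed

lemma support_function_le:
  assumes "K \<noteq> {}" "\<And>y. y \<in> K \<Longrightarrow> x \<bullet> y \<le> c"
  shows "support_function K x \<le> c"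
  unfolding support_function_def using assms by (intro cSUP_least) auto

text \<open>The foot of \<open>x\<close> maximises the inner product with the normal over
  \<open>K\<close>, so the distance of \<open>x\<close> is its height above a supporting hyperplane.
  This converts bounds on support functions into bounds on distances.\<close>

lemma support_function_outer_normal:
  assumes K: "compact K" "convex K" "K \<noteq> {}" and x: "x \<notin> K"
  shows "support_function K (outer_normal K x) + infdist x K = outer_normal K x \<bullet> x"
proof -
  have cl: "closed K" using K by (simp add: compact_imp_closed)
  note px = outer_normal_props[OF cl K(2,3) x]
  have "support_function K (outer_normal K x) = outer_normal K x \<bullet> closest_point K x"
    using px(4) by (intro antisym support_function_le support_function_ge K px(1)) (simp add: inner_diff_right)
  moreover have "outer_normal K x \<bullet> x = outer_normal K x \<bullet> (closest_point K x + infdist x K *\<^sub>R outer_normal K x)"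
    using px(3) by simp
  ultimately show ?thesis using px(2) by (simp add: inner_add_right dot_square_norm)
qed

lemma infdist_le_triangle_sets:
  assumes M: "M \<noteq> {}" "\<And>y. y \<in> M \<Longrightarrow> infdist y K \<le> r"
  shows "infdist x K \<le> infdist x M + r"
proof -
  have "infdist x K - r \<le> dist x y" if "y \<in> M" for y
    using infdist_triangle[of x K y] M(2)[OF that] by simp
  then have "infdist x K - r \<le> infdist x M"
    unfolding infdist_notempty[OF M(1)] using M(1) by (intro cINF_greatest) auto
  then show ?thesis by simp
qed

text \<open>The nearest point in \<open>K\<close> also belongs to \<open>M\<close>, so the triangle
  formed by \<open>x\<close> and the two feet has an angle of at least ninety degrees at the foot in
  \<open>M\<close>. Convergence of distances thereby forces convergence of feet.\<close>

lemma closest_point_superset: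
  assumes K: "closed K" "convex K" "K \<noteq> {}" and M: "closed M" "convex M" "K \<subseteq> M"
  shows "(norm (closest_point K x - closest_point M x))\<^sup>2 \<le> (infdist x K)\<^sup>2 - (infdist x M)\<^sup>2"
proof -
  have "M \<noteq> {}" using K M by auto
  define p q where "p = closest_point K x" "q = closest_point M x"
  have "p \<in> M" using closest_point_in_set[OF K(1,3)] M by (auto simp: p_q_def)
  then have "(x - q) \<bullet> (p - q) \<le> 0" unfolding p_q_def using closest_point_dot M by blast
  moreover have "(norm (x - p))\<^sup>2 = (norm (x - q))\<^sup>2 + (norm (p - q))\<^sup>2 - 2 * ((x - q) \<bullet> (p - q))"
    unfolding power2_norm_eq_inner by (simp add: inner_simps inner_commute algebra_simps)
  ultimately show ?thesis
    using infdist_closest_point[OF K(1,3), of x] infdist_closest_point[OF M(1) \<open>M \<noteq> {}\<close>, of x]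
    by (simp add: p_q_def)
qed

text \<open>Distances are squeezed between \<open>infdist x K - r i\<close> and
  \<open>infdist x K\<close>; the feet then converge by \<open>closest_point_superset\<close>, and
  the normals because the limit distance is positive.\<close>

lemma outer_normal_tendsto:
  assumes K: "compact K" "convex K" "K \<noteq> {}"
    and M: "\<And>i::nat. compact (M i)" "\<And>i. convex (M i)" "\<And>i. K \<subseteq> M i"
    and r: "eventually (\<lambda>i. \<forall>y\<in>M i. infdist y K \<le> r i) sequentially" "r \<longlonglongrightarrow> 0"
    and x: "x \<notin> K"
  shows "(\<lambda>i. infdist x (M i)) \<longlonglongrightarrow> infdist x K" "(\<lambda>i. outer_normal (M i) x) \<longlonglongrightarrow> outer_normal K x"
proof -
  have cl: "closed K" "closed (M i)" for i using K M by (simp_all add: compact_imp_closed)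
  have Mne: "M i \<noteq> {}" for i using K M(3)[of i] by auto
  have pos: "0 < infdist x K" using x infdist_pos_iff[OF cl(1) K(3)] by blast
  show d: "(\<lambda>i. infdist x (M i)) \<longlonglongrightarrow> infdist x K"
  proof (rule tendsto_sandwich)
    show "eventually (\<lambda>i. infdist x K - r i \<le> infdist x (M i)) sequentially"
      using r(1)
    proof eventually_elim
      case (elim i)
      then show ?case using infdist_le_triangle_sets[OF Mne, of i K "r i" x] by simp
    qed
    show "eventually (\<lambda>i. infdist x (M i) \<le> infdist x K) sequentially"
      using infdist_mono[OF M(3) K(3)] by simp
    show "(\<lambda>i. infdist x K - r i) \<longlonglongrightarrow> infdist x K"
      using tendsto_diff[OF tendsto_const r(2), of "infdist x K"] by simp
  qed simp
  have p: "(\<lambda>i. closest_point (M i) x) \<longlonglongrightarrow> closest_point K x"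
  proof (rule LIM_zero_cancel, rule tendsto_norm_zero_cancel)
    have "(\<lambda>i. sqrt ((infdist x K)\<^sup>2 - (infdist x (M i))\<^sup>2)) \<longlonglongrightarrow> sqrt ((infdist x K)\<^sup>2 - (infdist x K)\<^sup>2)"
      by (intro tendsto_intros d)
    then have lim: "(\<lambda>i. sqrt ((infdist x K)\<^sup>2 - (infdist x (M i))\<^sup>2)) \<longlonglongrightarrow> 0" by simp
    show "(\<lambda>i. norm (closest_point (M i) x - closest_point K x)) \<longlonglongrightarrow> 0"
    proof (rule tendsto_sandwich[OF _ _ tendsto_const lim])
      show "eventually (\<lambda>i. norm (closest_point (M i) x - closest_point K x) \<le> sqrt ((infdist x K)\<^sup>2 - (infdist x (M i))\<^sup>2)) sequentially"
        using closest_point_superset[OF cl(1) K(2,3) cl(2) M(2,3), of x]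
        by (intro always_eventually allI real_le_rsqrt) (simp add: norm_minus_commute)
    qed simp
  qed
  show "(\<lambda>i. outer_normal (M i) x) \<longlonglongrightarrow> outer_normal K x"
    unfolding outer_normal_def using pos by (intro tendsto_intros p d) auto
qed

text \<open>A point outside both \<open>K\<close> and its layer satisfies a strict inequality, which
  survives the convergence of distance and normal; a point of \<open>K\<close> lies in every
  \<open>M i\<close>. So each point eventually leaves \<open>A i - A0\<close>, and dominated
  convergence makes the excess volume vanish. Points on the edge of the limit layer may behave
  either way, hence the one-sided bound.\<close>

lemma outer_region_eventually_le_limit:
  assumes K: "compact K" "convex K" "K \<noteq> {}"
    and M: "\<And>i::nat. compact (M i)" "\<And>i. convex (M i)" "\<And>i. K \<subseteq> M i"
    and r: "eventually (\<lambda>i. \<forall>y\<in>M i. infdist y K \<le> r i) sequentially" "r \<longlonglongrightarrow> 0"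
    and k: "continuous_on (sphere 0 1) k" and t: "0 < t" and \<eta>: "0 < \<eta>"
  shows "eventually (\<lambda>i. measure lborel (outer_region (M i) k t) \<le> measure lborel (outer_region K k t) + \<eta>) sequentially"
proof -
  have cl: "closed K" "closed (M i)" for i using K M by (simp_all add: compact_imp_closed)
  have Mne: "M i \<noteq> {}" for i using K M(3)[of i] by auto
  define A where "A i = outer_region (M i) k t" for i
  define A0 where "A0 = outer_region K k t"
  have fm: "A i \<in> fmeasurable lborel" "A0 \<in> fmeasurable lborel" for i
    unfolding A_def A0_def using t by (intro outer_region_lmeasurable M K k Mne less_imp_le; assumption)+
  note sets = fmeasurableD[OF fm(1)] fmeasurableD[OF fm(2)]
  obtain B where B: "0 < B" "\<And>u. u \<in> sphere 0 1 \<Longrightarrow> \<bar>k u\<bar> \<le> B"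
    using continuous_on_sphere_bounded[OF k] by blast
  \<comment> \<open>The layer contributes at most \<open>t * B\<close> to the distance from
    \<open>K\<close>, and \<open>r i\<close> is eventually below 1.\<close>
  define C where "C = {x. infdist x K \<le> t * B + 1}"
  have C: "C \<in> fmeasurable lborel"
  proof (rule fmeasurableI)
    show "C \<in> sets lborel" unfolding C_def
      by (simp, intro borel_closed closed_Collect_le continuous_intros)
    show "emeasure lborel C < \<infinity>" unfolding C_def
      by (rule emeasure_bounded_finite[OF bounded_infdist_le[OF compact_imp_bounded[OF K(1)] K(3)]])
  qed
  have AC: "eventually (\<lambda>i. A i \<subseteq> C) sequentially"
    using r(1) order_tendstoD(2)[OF r(2) zero_less_one]
  proof eventually_elim
    case (elim i)
    show ?case
    proof
      fix x assume x: "x \<in> A i"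
      then have "x \<notin> M i" using infdist_pos_iff[OF cl(2) Mne] by (auto simp: A_def outer_region_def)
      then have "outer_normal (M i) x \<in> sphere 0 1" by (rule outer_normal_in_sphere[OF cl(2) M(2) Mne])
      then have "t * k (outer_normal (M i) x) \<le> t * B" using B(2) t by (intro mult_left_mono) force+
      then have "infdist x (M i) \<le> t * B" using x by (simp add: A_def outer_region_def)
      moreover have "infdist x K \<le> infdist x (M i) + r i"
        by (rule infdist_le_triangle_sets[OF Mne]) (use elim in blast)
      ultimately show "x \<in> C" using elim by (simp add: C_def)
    qed
  qed
  \<comment> \<open>Intersecting with \<open>C\<close> gives a majorant for every index, whereas
    \<open>A i \<subseteq> C\<close> is known only eventually.\<close>
  have "(\<lambda>i. \<integral>x. indicator ((A i - A0) \<inter> C) x \<partial>lborel) \<longlonglongrightarrow> (\<integral>x. 0 \<partial>(lborel::'a measure) :: real)"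
  proof (rule integral_dominated_convergence[where w = "indicator C"])
    show "integrable lborel (indicator C :: 'a \<Rightarrow> real)"
      by (rule integrable_real_indicator[OF fmeasurableD[OF C]]) (use fmeasurableD2[OF C] in \<open>simp add: less_top[symmetric]\<close>)
    show "(\<lambda>x. indicator ((A i - A0) \<inter> C) x :: real) \<in> borel_measurable lborel" for i
      using sets fmeasurableD[OF C] by (intro borel_measurable_indicator) blast
    show "AE x in lborel. (\<lambda>i. indicator ((A i - A0) \<inter> C) x :: real) \<longlonglongrightarrow> 0"
    proof (rule AE_I2)
      fix x :: 'a
      have "eventually (\<lambda>i. x \<notin> A i - A0) sequentially"
      proof (cases "x \<in> K \<or> x \<in> A0")
        case True
        have "x \<notin> A i" if "x \<in> K" for i
          using that M(3)[of i] by (auto simp: A_def outer_region_def)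
        then show ?thesis using True by auto
      next
        case False
        then have x: "x \<notin> K" and "0 < infdist x K" using infdist_pos_iff[OF cl(1) K(3)] by auto
        then have lt: "0 < infdist x K - t * k (outer_normal K x)"
          using False by (simp add: A0_def outer_region_def)
        have u: "outer_normal K x \<in> sphere 0 1" by (rule outer_normal_in_sphere[OF cl(1) K(2,3) x])
        note lim = outer_normal_tendsto[OF K M r x]
        have "eventually (\<lambda>i. 0 < infdist x (M i)) sequentially"
          by (rule order_tendstoD(1)[OF lim(1) \<open>0 < infdist x K\<close>])
        then have "eventually (\<lambda>i. outer_normal (M i) x \<in> sphere 0 1) sequentially"
        proof eventually_elim
          case (elim i)
          then show ?case
            using infdist_pos_iff[OF cl(2) Mne] outer_normal_in_sphere[OF cl(2) M(2) Mne] by blast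
        qed
        then have "(\<lambda>i. k (outer_normal (M i) x)) \<longlonglongrightarrow> k (outer_normal K x)"
          by (rule continuous_on_tendsto_compose[OF k lim(2) u])
        then have "(\<lambda>i. infdist x (M i) - t * k (outer_normal (M i) x)) \<longlonglongrightarrow> infdist x K - t * k (outer_normal K x)"
          by (intro tendsto_intros lim(1))
        from order_tendstoD(1)[OF this lt] show ?thesis
          by eventually_elim (simp add: A_def outer_region_def)
      qed
      then show "(\<lambda>i. indicator ((A i - A0) \<inter> C) x :: real) \<longlonglongrightarrow> 0"
        by (intro tendsto_eventually, elim eventually_mono) simp
    qed
    show "AE x in lborel. norm (indicator ((A i - A0) \<inter> C) x :: real) \<le> indicator C x" for i
      by (auto simp: indicator_def)
  qed auto
  then have "(\<lambda>i. measure lborel ((A i - A0) \<inter> C)) \<longlonglongrightarrow> 0" by simp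
  then have "eventually (\<lambda>i. measure lborel ((A i - A0) \<inter> C) < \<eta>) sequentially"
    using \<eta> by (rule order_tendstoD(2))
  with AC show ?thesis
  proof eventually_elim
    case (elim i)
    have "measure lborel (A i) \<le> measure lborel (A0 \<union> ((A i - A0) \<inter> C))"
      using elim(1) fm C sets fmeasurableD[OF C]
      by (intro measure_mono_fmeasurable fmeasurable.Un fmeasurable.Int fmeasurable.Diff) blast+
    also have "\<dots> \<le> measure lborel A0 + measure lborel ((A i - A0) \<inter> C)"
      using sets fmeasurableD[OF C] by (intro measure_Un_le) blast+
    finally show ?case using elim(2) by (simp add: A_def A0_def)
  qed
qed

section \<open>Upper and lower bounds for the growth of volume\<close>

lemma local_parallel_set_sphere:
  assumes "compact K" "convex K" "K \<noteq> {}"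
  shows "local_parallel_set K t (sphere 0 1) = {x. infdist x K \<le> t} - K"
proof (rule set_eqI)
  fix x
  have cl: "closed K" using assms(1) by (rule compact_imp_closed)
  show "x \<in> local_parallel_set K t (sphere 0 1) \<longleftrightarrow> x \<in> {x. infdist x K \<le> t} - K"
  proof (cases "x \<in> K")
    case False
    then have "outer_normal K x \<in> sphere 0 1" "0 < infdist x K"
      using outer_normal_in_sphere[OF cl assms(2,3)] infdist_pos_iff[OF cl assms(3)] by blast+
    then show ?thesis using False by (simp add: local_parallel_set_eq)
  qed (simp add: local_parallel_set_eq)
qed

text \<open>The bound on support functions carries no error term of its own: an error
  \<open>e i * \<eta>\<close> in an expansion is absorbed by taking \<open>g + \<eta>\<close> for
  \<open>g\<close>.\<close>

lemma volume_variation_upper: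
  assumes K: "compact K" "convex K" "K \<noteq> {}"
    and g: "continuous_on (sphere 0 1) g" "\<And>u. u \<in> sphere 0 1 \<Longrightarrow> 0 \<le> g u"
    and M: "\<And>i::nat. compact (M i)" "\<And>i. convex (M i)"
    and e: "\<And>i. 0 < e i" "e \<longlonglongrightarrow> 0"
    and h: "eventually (\<lambda>i. \<forall>u\<in>sphere 0 1. support_function (M i) u \<le> support_function K u + e i * g u) sequentially"
    and \<eta>: "0 < \<eta>"
  shows "eventually (\<lambda>i. measure lborel (M i) - measure lborel K \<le> e i * ((\<integral>u. g u \<partial>surface_area_measure K) + \<eta>)) sequentially"
proof -
  have cl: "closed K" using K by (simp add: compact_imp_closed)
  have "e i \<noteq> 0" for i using e(1)[of i] by simp
  then have lim: "filterlim e (at_right 0) sequentially"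
    unfolding filterlim_at using e by (auto intro: always_eventually)
  have "eventually (\<lambda>t. measure lborel (outer_region K g t) \<le>
      t * ((\<integral>u. g u \<partial>surface_area_measure K) + \<eta>)) (at_right 0)"
    by (rule outer_region_eventually_le[OF K g(1) _ \<eta>]) (rule g(2))
  from h eventually_compose_filterlim[OF this lim] show ?thesis
  proof eventually_elim
    case (elim i)
    have fm: "outer_region K g (e i) \<in> fmeasurable lborel"
      using e(1)[of i] by (intro outer_region_lmeasurable K g) auto
    have fK: "K \<in> fmeasurable lborel" "M i \<in> fmeasurable lborel"
      using K M by (auto intro: fmeasurable_compact)
    have "M i \<subseteq> K \<union> outer_region K g (e i)"
    proof
      fix x assume x: "x \<in> M i"
      show "x \<in> K \<union> outer_region K g (e i)"
      proof (cases "x \<in> K")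
        case False
        then have pos: "0 < infdist x K" using infdist_pos_iff[OF cl K(3)] by blast
        have "outer_normal K x \<bullet> x \<le> support_function K (outer_normal K x) + e i * g (outer_normal K x)"
          using support_function_ge[OF M(1) x] elim(1) outer_normal_in_sphere[OF cl K(2,3) False] order_trans by blast
        then show ?thesis using support_function_outer_normal[OF K False] pos by (simp add: outer_region_def)
      qed simp
    qed
    then have "measure lborel (M i) \<le> measure lborel (K \<union> outer_region K g (e i))"
      using fm fK by (intro measure_mono_fmeasurable fmeasurable.Un) (auto simp del: sets_lborel dest: fmeasurableD)
    also have "\<dots> \<le> measure lborel K + measure lborel (outer_region K g (e i))"
      using fm fK by (intro measure_Un_le fmeasurableD)
    finally show ?case using elim(2) by simp
  qed
qed

text \<open>A lower bound for the volume of \<open>M i\<close> is an upper bound for the part of the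
  parallel body \<open>{x. infdist x K \<le> c * e i}\<close> outside \<open>M i\<close>. Monotonicity of the quotient for \<open>M i\<close>
  replaces the scale \<open>e i\<close> by a fixed scale, at which the outer regions of \<open>M i\<close> tend to that of \<open>K\<close>.\<close>

lemma volume_variation_lower:
  assumes K: "compact K" "convex K" "K \<noteq> {}"
    and g: "continuous_on (sphere 0 1) g"
    and M: "\<And>i::nat. compact (M i)" "\<And>i. convex (M i)" "\<And>i. K \<subseteq> M i"
    and r: "eventually (\<lambda>i. \<forall>y\<in>M i. infdist y K \<le> r i) sequentially" "r \<longlonglongrightarrow> 0"
    and e: "\<And>i. 0 < e i" "e \<longlonglongrightarrow> 0"
    and h: "eventually (\<lambda>i. \<forall>u\<in>sphere 0 1. support_function K u + e i * g u \<le> support_function (M i) u) sequentially"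
    and \<eta>: "0 < \<eta>"
  shows "eventually (\<lambda>i. e i * ((\<integral>u. g u \<partial>surface_area_measure K) - \<eta>) \<le> measure lborel (M i) - measure lborel K) sequentially"
proof -
  let ?S = "surface_area_measure K"
  have cl: "closed K" "closed (M i)" for i using K M by (simp_all add: compact_imp_closed)
  have Mne: "M i \<noteq> {}" for i using K M(3)[of i] by auto
  interpret finite_measure ?S by (rule finite_measure_surface_area_measure[OF K])
  obtain c where c: "0 < c" "\<And>u. u \<in> sphere 0 1 \<Longrightarrow> \<bar>g u\<bar> \<le> c"
    using continuous_on_sphere_bounded[OF g] by blast
  define a where "a = measure ?S (space ?S)"
  have a: "0 \<le> a" by (simp add: a_def)
  \<comment> \<open>Three errors add up to \<open>\<eta>\<close>: \<open>\<delta> * a\<close> from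
    integrating the rounding term in \<open>k + \<delta>\<close>, one \<open>\<delta>\<close> from
    the volume estimate for \<open>K\<close> at scale \<open>t\<close>, and one from passing from
    \<open>M i\<close> to \<open>K\<close>.\<close>
  define \<delta> where "\<delta> = \<eta> / (a + 2)"
  have \<delta>: "0 < \<delta>" using a \<eta> by (simp add: \<delta>_def)
  have \<delta>a: "\<delta> * a + 2 * \<delta> = \<eta>"
  proof -
    have "a + 2 \<noteq> 0" using a by linarith
    then have "\<delta> * (a + 2) = \<eta>" by (simp add: \<delta>_def)
    then show ?thesis by (simp add: algebra_simps)
  qed
  \<comment> \<open>\<open>k\<close> is the thickness of the gap between \<open>M i\<close> and the
    parallel body of \<open>K\<close>; the choice of \<open>c\<close> makes it nonnegative.\<close>
  define k where "k = (\<lambda>u. c - g u)"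
  have k: "continuous_on (sphere 0 1) k" unfolding k_def by (intro continuous_intros g)
  have k0: "0 \<le> k u" if "u \<in> sphere 0 1" for u using c(2)[OF that] by (simp add: k_def)
  have k': "continuous_on (sphere 0 1) (\<lambda>u. k u + \<delta>)" by (intro continuous_intros k)
  have k0': "0 \<le> k u + \<delta>" if "u \<in> sphere 0 1" for u using k0[OF that] \<delta> by simp
  have int: "(\<integral>u. k u + \<delta> \<partial>?S) = c * a - (\<integral>u. g u \<partial>?S) + \<delta> * a"
    unfolding k_def using integrable_surface_area_measure[OF K g] by (simp add: a_def mult.commute)
  obtain t where t: "0 < t" "measure lborel (outer_region K (\<lambda>u. k u + \<delta>) t) \<le> t * ((\<integral>u. k u + \<delta> \<partial>?S) + \<delta>)"
    using eventually_happens[OF eventually_conj[OF eventually_at_right_less outer_region_eventually_le[OF K k' k0' \<delta>]]]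
    by auto
  have "eventually (\<lambda>i. measure lborel (outer_region (M i) (\<lambda>u. k u + \<delta>) t) \<le> measure lborel (outer_region K (\<lambda>u. k u + \<delta>) t) + t * \<delta>) sequentially"
    using t \<delta> by (intro outer_region_eventually_le_limit[OF K M r k']) auto
  with h order_tendstoD(2)[OF e(2) t(1)] show ?thesis
  proof eventually_elim
    case (elim i)
    define P where "P = {x. infdist x K \<le> e i * c}"
    have ec: "0 < e i * c" using e(1) c(1) by simp
    have fP: "P \<in> fmeasurable lborel"
    proof (rule fmeasurableI)
      show "P \<in> sets lborel" unfolding P_def
        by (simp, intro borel_closed closed_Collect_le continuous_intros)
      show "emeasure lborel P < \<infinity>" unfolding P_def
        by (rule emeasure_bounded_finite[OF bounded_infdist_le[OF compact_imp_bounded[OF K(1)] K(3)]])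
    qed
    have fM: "M i \<in> fmeasurable lborel" "K \<in> fmeasurable lborel"
      using K M by (auto intro: fmeasurable_compact)
    have fW: "outer_region (M i) k (e i) \<in> fmeasurable lborel"
      using e(1)[of i] by (intro outer_region_lmeasurable M Mne k) auto
    have "P \<subseteq> M i \<union> outer_region (M i) k (e i)"
    proof
      fix x assume x: "x \<in> P"
      show "x \<in> M i \<union> outer_region (M i) k (e i)"
      proof (cases "x \<in> M i")
        case False
        define u where "u = outer_normal (M i) x"
        have u: "u \<in> sphere 0 1" unfolding u_def by (rule outer_normal_in_sphere[OF cl(2) M(2) Mne False])
        have pos: "0 < infdist x (M i)" using False infdist_pos_iff[OF cl(2) Mne] by blast
        \<comment> \<open>Here \<open>u\<close> is a normal of \<open>M i\<close>, while the nearest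
          point is taken in \<open>K\<close>: a point of the parallel body exceeds the support
          function of \<open>K\<close> by at most \<open>e i * c\<close> in every unit
          direction.\<close>
        have "u \<bullet> x = u \<bullet> closest_point K x + u \<bullet> (x - closest_point K x)" by (simp add: inner_diff_right)
        also have "\<dots> \<le> support_function K u + norm u * norm (x - closest_point K x)"
          by (intro add_mono support_function_ge[OF K(1)] closest_point_in_set cl K norm_cauchy_schwarz)
        also have "\<dots> \<le> support_function K u + e i * c"
          using x u infdist_closest_point[OF cl(1) K(3), of x] by (simp add: P_def)
        finally have "support_function (M i) u + infdist x (M i) \<le> support_function K u + e i * c"
          using support_function_outer_normal[OF M(1,2) Mne False] by (simp add: u_def)
        moreover have "support_function K u + e i * g u \<le> support_function (M i) u" using elim(1) u by blast
        ultimately have "infdist x (M i) \<le> e i * k u" by (simp add: k_def algebra_simps)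
        then show ?thesis using pos by (simp add: outer_region_def u_def)
      qed simp
    qed
    then have "measure lborel P \<le> measure lborel (M i \<union> outer_region (M i) k (e i))"
      using fP fM fW by (intro measure_mono_fmeasurable fmeasurable.Un fmeasurableD)
    also have "\<dots> \<le> measure lborel (M i) + measure lborel (outer_region (M i) k (e i))"
      using fM fW by (intro measure_Un_le fmeasurableD)
    finally have 1: "measure lborel P \<le> measure lborel (M i) + measure lborel (outer_region (M i) k (e i))" .
    have "K \<subseteq> P" using ec by (auto simp: P_def)
    then have "measure lborel (local_parallel_set K (e i * c) (sphere 0 1)) = measure lborel P - measure lborel K"
      unfolding local_parallel_set_sphere[OF K] P_def[symmetric]
      using fP fM by (intro measurable_measure_Diff) (auto simp del: sets_lborel dest: fmeasurableD)
    moreover have "a * (e i * c) \<le> measure lborel (local_parallel_set K (e i * c) (sphere 0 1))"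
      unfolding a_def using surface_area_measure_le_local_parallel_quotient[OF K sets.top ec]
      by (simp add: space_surface_area_measure)
    ultimately have 2: "a * (e i * c) + measure lborel K \<le> measure lborel P" by simp
    have "measure lborel (outer_region (M i) k (e i)) \<le> e i / t * measure lborel (outer_region (M i) (\<lambda>u. k u + \<delta>) t)"
      using elim(2) by (intro outer_region_quotient_mono M Mne k k0 \<delta> e) auto
    also have "\<dots> \<le> e i / t * (t * ((\<integral>u. k u + \<delta> \<partial>?S) + \<delta>) + t * \<delta>)"
      using elim(3) t e(1)[of i] by (intro mult_left_mono) auto
    also have "\<dots> = e i * ((\<integral>u. k u + \<delta> \<partial>?S) + 2 * \<delta>)"
      using t by (simp add: field_simps)
    also have "\<dots> = e i * (c * a - (\<integral>u. g u \<partial>?S) + \<eta>)"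
      unfolding int \<delta>a[symmetric] by (simp add: algebra_simps)
    finally show ?case using 1 2 by (simp add: algebra_simps)
  qed
qed

text \<open>Hypothesis \<open>h\<close> is a first-order expansion that is uniform on the sphere.
  Sequences are used because the lower bound rests on dominated convergence.\<close>

lemma volume_variation:
  assumes K: "compact K" "convex K" "K \<noteq> {}"
    and g: "continuous_on (sphere 0 1) g" "\<And>u. u \<in> sphere 0 1 \<Longrightarrow> 0 \<le> g u"
    and M: "\<And>i::nat. compact (M i)" "\<And>i. convex (M i)" "\<And>i. K \<subseteq> M i"
    and e: "\<And>i. 0 < e i" "e \<longlonglongrightarrow> 0"
    and h: "\<And>\<eta>. 0 < \<eta> \<Longrightarrow> eventually (\<lambda>i. \<forall>u\<in>sphere 0 1.
        \<bar>support_function (M i) u - support_function K u - e i * g u\<bar> \<le> e i * \<eta>) sequentially"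
  shows "(\<lambda>i. (measure lborel (M i) - measure lborel K) / e i) \<longlonglongrightarrow> (\<integral>u. g u \<partial>surface_area_measure K)"
proof -
  let ?S = "surface_area_measure K"
  interpret finite_measure ?S by (rule finite_measure_surface_area_measure[OF K])
  define a where "a = measure ?S (space ?S)"
  have a: "0 \<le> a" by (simp add: a_def)
  have cl: "closed K" using K by (simp add: compact_imp_closed)
  obtain c where c: "0 < c" "\<And>u. u \<in> sphere 0 1 \<Longrightarrow> \<bar>g u\<bar> \<le> c"
    using continuous_on_sphere_bounded[OF g(1)] by blast
  \<comment> \<open>The expansion with \<open>\<eta> = 1\<close> already confines \<open>M i\<close>
    to a shrinking parallel body of \<open>K\<close>.\<close>
  have r: "eventually (\<lambda>i. \<forall>y\<in>M i. infdist y K \<le> e i * (c + 1)) sequentially"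
    using h[OF zero_less_one]
  proof eventually_elim
    case (elim i)
    show ?case
    proof
      fix y assume y: "y \<in> M i"
      show "infdist y K \<le> e i * (c + 1)"
      proof (cases "y \<in> K")
        case False
        let ?u = "outer_normal K y"
        have u: "?u \<in> sphere 0 1" by (rule outer_normal_in_sphere[OF cl K(2,3) False])
        have "infdist y K \<le> support_function (M i) ?u - support_function K ?u"
          using support_function_outer_normal[OF K False] support_function_ge[OF M(1) y, of ?u] by simp
        also have "\<dots> \<le> e i * g ?u + e i * 1"
          using bspec[OF elim u] by linarith
        also have "\<dots> \<le> e i * c + e i * 1"
          using c(2)[OF u] e(1)[of i] by (intro add_right_mono mult_left_mono) auto
        finally show ?thesis by (simp add: algebra_simps)
      qed (use c e(1)[of i] in auto)
    qed
  qed
  have r0: "(\<lambda>i. e i * (c + 1)) \<longlonglongrightarrow> 0" using tendsto_mult[OF e(2) tendsto_const, of "c + 1"] by simp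
  show ?thesis
  proof (rule metric_LIMSEQ_I)
    fix \<epsilon> :: real assume \<epsilon>: "0 < \<epsilon>"
    \<comment> \<open>Replacing \<open>g\<close> by \<open>g + \<eta>\<close> or
      \<open>g - \<eta>\<close> changes the integral by \<open>\<eta> * a\<close>, and each volume
      bound loses another \<open>\<eta>\<close>; together this is half of
      \<open>\<epsilon>\<close>.\<close>
    define \<eta> where "\<eta> = \<epsilon> / 2 / (a + 1)"
    have \<eta>: "0 < \<eta>" using \<epsilon> a by (simp add: \<eta>_def)
    have \<eta>a: "\<eta> * a + \<eta> = \<epsilon> / 2"
    proof -
      have "a + 1 \<noteq> 0" using a by linarith
      then have "\<eta> * (a + 1) = \<epsilon> / 2" unfolding \<eta>_def by (rule nonzero_eq_divide_eq[THEN iffD1]) (rule refl)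
      then show ?thesis by (simp add: algebra_simps)
    qed
    have gi: "integrable ?S g" by (rule integrable_surface_area_measure[OF K g(1)])
    have "eventually (\<lambda>i. measure lborel (M i) - measure lborel K \<le> e i * ((\<integral>u. g u + \<eta> \<partial>?S) + \<eta>)) sequentially"
    proof (rule volume_variation_upper[OF K _ _ M(1,2) e _ \<eta>])
      show "continuous_on (sphere 0 1) (\<lambda>u. g u + \<eta>)" by (intro continuous_intros g)
      show "eventually (\<lambda>i. \<forall>u\<in>sphere 0 1. support_function (M i) u \<le> support_function K u + e i * (g u + \<eta>)) sequentially"
        using h[OF \<eta>]
      proof eventually_elim
        case (elim i)
        show ?case
        proof
          fix u :: 'a assume "u \<in> sphere 0 1"
          from bspec[OF elim this] show "support_function (M i) u \<le> support_function K u + e i * (g u + \<eta>)"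
            unfolding distrib_left by linarith
        qed
      qed
    qed (use g(2) \<eta> in fastforce)
    moreover have "eventually (\<lambda>i. e i * ((\<integral>u. g u - \<eta> \<partial>?S) - \<eta>) \<le> measure lborel (M i) - measure lborel K) sequentially"
    proof (rule volume_variation_lower[OF K _ M r r0 e _ \<eta>])
      show "continuous_on (sphere 0 1) (\<lambda>u. g u - \<eta>)" by (intro continuous_intros g)
      show "eventually (\<lambda>i. \<forall>u\<in>sphere 0 1. support_function K u + e i * (g u - \<eta>) \<le> support_function (M i) u) sequentially"
        using h[OF \<eta>]
      proof eventually_elim
        case (elim i)
        show ?case
        proof
          fix u :: 'a assume "u \<in> sphere 0 1"
          from bspec[OF elim this] show "support_function K u + e i * (g u - \<eta>) \<le> support_function (M i) u"
            unfolding right_diff_distrib by linarith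
        qed
      qed
    qed
    ultimately have "eventually (\<lambda>i. dist ((measure lborel (M i) - measure lborel K) / e i) (\<integral>u. g u \<partial>?S) < \<epsilon>) sequentially"
    proof eventually_elim
      case (elim i)
      define v where "v = measure lborel (M i) - measure lborel K"
      have 1: "(\<integral>u. g u + \<eta> \<partial>?S) + \<eta> = (\<integral>u. g u \<partial>?S) + \<epsilon> / 2"
        using gi \<eta>a by (simp add: a_def mult.commute)
      have 2: "(\<integral>u. g u - \<eta> \<partial>?S) - \<eta> = (\<integral>u. g u \<partial>?S) - \<epsilon> / 2"
        using gi \<eta>a by (simp add: a_def mult.commute)
      have "v / e i \<le> (\<integral>u. g u \<partial>?S) + \<epsilon> / 2" "(\<integral>u. g u \<partial>?S) - \<epsilon> / 2 \<le> v / e i"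
        using elim e(1)[of i] unfolding 1 2 v_def[symmetric] by (simp_all add: pos_divide_le_eq pos_le_divide_eq mult.commute)
      then show ?case using \<epsilon> unfolding v_def[symmetric] dist_real_def by linarith
    qed
    then show "\<exists>no. \<forall>n\<ge>no. dist ((measure lborel (M n) - measure lborel K) / e n) (\<integral>u. g u \<partial>?S) < \<epsilon>"
      by (simp add: eventually_sequentially)
  qed
qed

section \<open>Sublinear functions as support functions\<close>

lemma mem_if_inner_le_support_function:
  assumes K: "compact K" "convex K" "K \<noteq> {}" and y: "\<And>x. x \<bullet> y \<le> support_function K x"
  shows "y \<in> K"
proof (rule ccontr)
  assume "y \<notin> K"
  then obtain a b where ab: "a \<bullet> y < b" "\<And>x. x \<in> K \<Longrightarrow> a \<bullet> x > b"
    using separating_hyperplane_closed_point[OF K(2) compact_imp_closed[OF K(1)]] by blast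
  have "support_function K (- a) \<le> - b"
    using ab(2) K(3) by (intro support_function_le) (auto simp: less_imp_le)
  then show False using y[of "- a"] ab(1) by simp
qed

lemma support_function_inject:
  assumes "compact K" "convex K" "K \<noteq> {}" "compact M" "convex M" "M \<noteq> {}"
    and eq: "\<And>x. support_function K x = support_function M x"
  shows "K = M"
proof
  show "K \<subseteq> M"
  proof
    fix y assume "y \<in> K"
    from support_function_ge[OF assms(1) this] show "y \<in> M"
      unfolding eq by (rule mem_if_inner_le_support_function[OF assms(4-6)])
  qed
  show "M \<subseteq> K"
  proof
    fix y assume "y \<in> M"
    from support_function_ge[OF assms(4) this] show "y \<in> K"
      unfolding eq[symmetric] by (rule mem_if_inner_le_support_function[OF assms(1-3)])
  qed
qed

lemma support_function_sublinear:
  assumes K: "compact K" "K \<noteq> {}"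
  shows "support_function K (x + y) \<le> support_function K x + support_function K y"
    and "0 \<le> c \<Longrightarrow> support_function K (c *\<^sub>R x) = c * support_function K x"
proof -
  show "support_function K (x + y) \<le> support_function K x + support_function K y"
    using support_function_ge[OF K(1)] by (intro support_function_le K(2)) (simp add: inner_add_left add_mono)
  assume c: "0 \<le> c"
  show "support_function K (c *\<^sub>R x) = c * support_function K x"
  proof (rule antisym)
    show "support_function K (c *\<^sub>R x) \<le> c * support_function K x"
      using support_function_ge[OF K(1)] c by (intro support_function_le K(2)) (simp add: mult_left_mono)
    show "c * support_function K x \<le> support_function K (c *\<^sub>R x)"
    proof (cases "c = 0")
      case True
      then show ?thesis using K(2) by (simp add: support_function_def)
    next
      case False
      then have c: "0 < c" using c by simp
      have "support_function K x \<le> support_function K (c *\<^sub>R x) / c"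
      proof (rule support_function_le[OF K(2)])
        fix y assume "y \<in> K"
        from support_function_ge[OF K(1) this, of "c *\<^sub>R x"] show "x \<bullet> y \<le> support_function K (c *\<^sub>R x) / c"
          using c by (simp add: field_simps)
      qed
      then show ?thesis using c by (simp add: field_simps)
    qed
  qed
qed

lemma sublinear_convex_continuous:
  fixes h :: "'a::euclidean_space \<Rightarrow> real"
  assumes add: "\<And>x y. h (x + y) \<le> h x + h y" and scale: "\<And>c x. 0 \<le> c \<Longrightarrow> h (c *\<^sub>R x) = c * h x"
  shows "convex_on UNIV h" "continuous_on UNIV h"
proof -
  show "convex_on UNIV h"
  proof (rule convex_onI)
    fix t :: real and x y :: 'a assume "0 < t" "t < 1"
    then show "h ((1 - t) *\<^sub>R x + t *\<^sub>R y) \<le> (1 - t) * h x + t * h y"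
      using add[of "(1 - t) *\<^sub>R x" "t *\<^sub>R y"] scale[of "1 - t" x] scale[of t y] by simp
  qed simp
  then show "continuous_on UNIV h" by (rule convex_on_continuous[OF open_UNIV])
qed

text \<open>A Hahn-Banach argument: \<open>(x0, t)\<close> is separated from the epigraph of
  \<open>h\<close>, a closed convex cone, and the separating hyperplane, moved to the origin, is the
  graph of the desired linear function.\<close>

lemma sublinear_linear_minorant_near:
  fixes h :: "'a::euclidean_space \<Rightarrow> real"
  assumes add: "\<And>x y. h (x + y) \<le> h x + h y" and scale: "\<And>c x. 0 \<le> c \<Longrightarrow> h (c *\<^sub>R x) = c * h x"
    and t: "t < h x0"
  obtains y where "\<And>x. x \<bullet> y \<le> h x" "t < x0 \<bullet> y"
proof -
  note h = sublinear_convex_continuous[OF add scale]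
  define E where "E = epigraph UNIV h"
  have "convex E" unfolding E_def using h by (simp add: convex_epigraph)
  moreover have "closed E"
    unfolding E_def epigraph_def
    by (simp, intro closed_Collect_le continuous_intros continuous_on_compose2[OF h(2)]) auto
  moreover have "(x0, t) \<notin> E" using t by (simp add: E_def epigraph_def)
  ultimately obtain v b where v: "v \<bullet> (x0, t) < b" "\<And>z. z \<in> E \<Longrightarrow> b < v \<bullet> z"
    using separating_hyperplane_closed_point by metis
  obtain a \<alpha> where a: "v = (a, \<alpha>)" by force
  have h0: "h 0 = 0" using scale[of 0 0] by simp
  have b: "b < 0" using v(2)[of "(0, 0)"] h0 by (simp add: E_def epigraph_def a)
  \<comment> \<open>On a cone a functional bounded below is nonnegative: scaling a point of negative
    value \<open>w\<close> by \<open>b / w\<close> would bring its value down to the excluded bound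
    \<open>b\<close>.\<close>
  have cone: "0 \<le> a \<bullet> x + \<alpha> * s" if "h x \<le> s" for x s
  proof (rule ccontr)
    assume neg: "\<not> 0 \<le> a \<bullet> x + \<alpha> * s"
    define w where "w = a \<bullet> x + \<alpha> * s"
    define c where "c = b / w"
    have w: "w < 0" using neg by (simp add: w_def)
    then have c: "0 < c" using b by (simp add: c_def divide_neg_neg)
    have "h (c *\<^sub>R x) \<le> c * s" using scale[of c x] c that by simp
    then have "b < v \<bullet> (c *\<^sub>R x, c * s)" by (intro v(2)) (simp add: E_def epigraph_def)
    also have "\<dots> = c * w" by (simp add: a w_def algebra_simps)
    also have "\<dots> = b" using w by (simp add: c_def)
    finally show False by simp
  qed
  have \<alpha>0: "0 \<le> \<alpha>" using cone[of 0 1] h0 by simp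
  have lt: "a \<bullet> x0 + \<alpha> * t < 0" using v(1) b by (simp add: a)
  \<comment> \<open>A vertical hyperplane could not separate \<open>(x0, t)\<close> from
    \<open>(x0, h x0)\<close>, which lies in the epigraph.\<close>
  have "\<alpha> \<noteq> 0" using cone[of x0 "h x0"] lt by auto
  then have \<alpha>: "0 < \<alpha>" using \<alpha>0 by simp
  show thesis
  proof (rule that[of "- (a /\<^sub>R \<alpha>)"])
    show "x \<bullet> - (a /\<^sub>R \<alpha>) \<le> h x" for x
      using cone[of x "h x"] \<alpha> by (simp add: inner_commute field_simps)
    show "t < x0 \<bullet> - (a /\<^sub>R \<alpha>)"
      using lt \<alpha> by (simp add: inner_commute field_simps)
  qed
qed

text \<open>\<open>M\<close> collects the linear minorants of \<open>h\<close>, and the minorants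
  nearly touching \<open>h\<close> at a given point make the supremum equal to \<open>h\<close>.
  Compactness comes from testing \<open>y\<close> against its own direction.\<close>

lemma sublinear_is_support_function:
  fixes h :: "'a::euclidean_space \<Rightarrow> real"
  assumes add: "\<And>x y. h (x + y) \<le> h x + h y" and scale: "\<And>c x. 0 \<le> c \<Longrightarrow> h (c *\<^sub>R x) = c * h x"
  defines "M \<equiv> {y. \<forall>x. x \<bullet> y \<le> h x}"
  shows "compact M" "convex M" "M \<noteq> {}" "support_function M x = h x"
proof -
  have M_eq: "M = (\<Inter>x. {y. x \<bullet> y \<le> h x})" by (auto simp: M_def)
  show "convex M" unfolding M_eq by (intro convex_INT convex_halfspace_le)
  have "closed M" unfolding M_eq by (intro closed_INT ballI closed_halfspace_le)
  moreover have "bounded M"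
  proof -
    have "continuous_on (sphere 0 1) h"
      using sublinear_convex_continuous(2)[OF add scale] continuous_on_subset by blast
    then obtain B where B: "0 < B" "\<And>u. u \<in> sphere 0 1 \<Longrightarrow> \<bar>h u\<bar> \<le> B"
      using continuous_on_sphere_bounded by blast
    have "norm y \<le> B" if y: "y \<in> M" for y
    proof (cases "y = 0")
      case False
      have "norm y = (y /\<^sub>R norm y) \<bullet> y" using False by (simp add: dot_square_norm power2_eq_square)
      also have "\<dots> \<le> h (y /\<^sub>R norm y)" using y by (simp add: M_def del: inner_scaleR_left)
      also have "\<dots> \<le> B" using B(2)[of "y /\<^sub>R norm y"] False by simp
      finally show ?thesis .
    qed (use B in simp)
    then show ?thesis unfolding bounded_iff by blast
  qed
  ultimately show M: "compact M" by (simp add: compact_eq_bounded_closed)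
  have near: "\<exists>y\<in>M. t < x0 \<bullet> y" if "t < h x0" for t x0
    using sublinear_linear_minorant_near[OF add scale that] unfolding M_def by blast
  show ne: "M \<noteq> {}" using near[of "h 0 - 1" 0] by auto
  show "support_function M x = h x"
  proof (rule antisym)
    show "support_function M x \<le> h x" by (rule support_function_le[OF ne]) (simp add: M_def)
    show "h x \<le> support_function M x"
    proof (rule dense_le)
      fix t assume "t < h x"
      with near obtain y where "y \<in> M" "t < x \<bullet> y" by blast
      then show "t \<le> support_function M x" using support_function_ge[OF M, of y x] by simp
    qed
  qed
qed

section \<open>Orlicz combinations\<close>

lemma orlicz_classD:
  assumes "\<phi> \<in> orlicz_class"
  shows "convex_on {0..} \<phi>" "\<And>s t. 0 \<le> s \<Longrightarrow> s \<le> t \<Longrightarrow> \<phi> s \<le> \<phi> t" "\<And>t. 0 \<le> t \<Longrightarrow> 0 \<le> \<phi> t"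
    "\<phi> 0 = 0" "\<phi> 1 = 1"
  using assms by (auto simp: orlicz_class_def mono_on_def)

lemma orlicz_class_scale_le:
  assumes "\<phi> \<in> orlicz_class" "0 \<le> c" "c \<le> 1" "0 \<le> t"
  shows "\<phi> (c * t) \<le> c * \<phi> t"
  using convex_onD[OF orlicz_classD(1)[OF assms(1)] assms(2,3), of 0 t] assms orlicz_classD(4)[OF assms(1)]
  by simp

lemma orlicz_class_ge_self:
  assumes "\<phi> \<in> orlicz_class" "1 \<le> t"
  shows "t \<le> \<phi> t"
proof -
  have "\<phi> (1 / t * t) \<le> 1 / t * \<phi> t" using assms by (intro orlicz_class_scale_le) auto
  then show ?thesis using assms orlicz_classD(5)[OF assms(1)] by (simp add: field_simps)
qed

lemma orlicz_class_le_self: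
  assumes "\<phi> \<in> orlicz_class" "0 \<le> t" "t \<le> 1"
  shows "\<phi> t \<le> t"
  using orlicz_class_scale_le[of \<phi> t 1] assms orlicz_classD(5)[OF assms(1)] by simp

text \<open>Convexity yields continuity in the open half-line only; at 0 the function is squeezed
  between 0 and the identity.\<close>

lemma orlicz_class_continuous:
  assumes \<phi>: "\<phi> \<in> orlicz_class"
  shows "continuous_on {0..} \<phi>"
proof -
  note d = orlicz_classD[OF \<phi>]
  have "convex_on {0<..} \<phi>" by (rule convex_on_subset[OF d(1)]) auto
  then have pos: "continuous_on {0<..} \<phi>" by (intro convex_on_continuous) auto
  have zero: "continuous (at 0 within {0..}) \<phi>"
  proof -
    have "(\<phi> \<longlongrightarrow> 0) (at 0 within {0..})"
    proof (rule tendsto_sandwich)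
      show "eventually (\<lambda>t. 0 \<le> \<phi> t) (at 0 within {0..})"
        unfolding eventually_at_filter using d(3) by simp
      show "eventually (\<lambda>t. \<phi> t \<le> t) (at 0 within {0..})"
        unfolding eventually_at using orlicz_class_le_self[OF \<phi>] by (intro exI[of _ 1]) (auto simp: dist_real_def)
    qed (auto intro: tendsto_ident_at)
    then show ?thesis by (simp add: continuous_within d(4))
  qed
  show ?thesis
    unfolding continuous_on_eq_continuous_within
  proof
    fix x :: real assume "x \<in> {0..}"
    then consider "x = 0" | "0 < x" by fastforce
    then show "continuous (at x within {0..}) \<phi>"
    proof cases
      case 2
      then have "continuous (at x) \<phi>" using pos by (simp add: continuous_on_eq_continuous_at)
      then show ?thesis by (rule continuous_at_imp_continuous_at_within)
    qed (use zero in simp)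
  qed
qed

text \<open>Chord slopes to the point 1 increase from the left, so they tend to their supremum. The
  slope from 0 equals 1, which bounds the derivative below, and every chord slope lies below the
  limit, which is the supporting line inequality.\<close>

lemma orlicz_class_left_deriv:
  assumes \<phi>: "\<phi> \<in> orlicz_class"
  shows "((\<lambda>y. (\<phi> y - 1) / (y - 1)) \<longlongrightarrow> left_deriv \<phi> 1) (at_left 1)"
    "1 \<le> left_deriv \<phi> 1" "\<And>y. 0 \<le> y \<Longrightarrow> y \<le> 1 \<Longrightarrow> 1 - left_deriv \<phi> 1 * (1 - y) \<le> \<phi> y"
proof -
  note d = orlicz_classD[OF \<phi>]
  define p where "p y = (\<phi> y - 1) / (y - 1)" for y
  have mono: "p x \<le> p y" if "0 \<le> x" "x \<le> y" "y < 1" for x y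
  proof (cases "x = y")
    case False
    then have "(\<phi> x - \<phi> 1) / (x - 1) \<le> (\<phi> y - \<phi> 1) / (y - 1)"
      using that by (intro convex_on_slope_le(2)[OF d(1)]) auto
    then show ?thesis by (simp add: p_def d(5))
  qed simp
  \<comment> \<open>The slope between 1 and 2 bounds the slopes on the left, so the supremum is
    finite.\<close>
  have "p y \<le> \<phi> 2 - 1" if "0 \<le> y" "y < 1" for y
  proof -
    have "(\<phi> y - \<phi> 1) / (y - 1) \<le> (\<phi> y - \<phi> 2) / (y - 2)" "(\<phi> y - \<phi> 2) / (y - 2) \<le> (\<phi> 1 - \<phi> 2) / (1 - 2)"
      using that by (intro convex_on_slope_le[OF d(1)]; simp)+
    then show ?thesis by (simp add: p_def d(5))
  qed
  then have bdd: "bdd_above (p ` {0..<1})" by (auto intro!: bdd_aboveI)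
  define D where "D = (SUP y\<in>{0..<1}. p y)"
  have le: "p y \<le> D" if "0 \<le> y" "y < 1" for y
    unfolding D_def using that by (intro cSUP_upper bdd) auto
  have lim: "(p \<longlongrightarrow> D) (at_left 1)"
  proof (rule order_tendstoI)
    fix a assume "a < D"
    then obtain x where x: "0 \<le> x" "x < 1" "a < p x"
      unfolding D_def using less_cSUP_iff[OF _ bdd] by auto
    then have "a < p y" if "x < y" "y < 1" for y using mono[of x y] that by simp
    then show "eventually (\<lambda>y. a < p y) (at_left 1)"
      unfolding eventually_at_left_field using x(2) by blast
  next
    fix a assume "D < a"
    then have "p y < a" if "0 < y" "y < 1" for y using le[of y] that by simp
    then show "eventually (\<lambda>y. p y < a) (at_left 1)"
      unfolding eventually_at_left_field using zero_less_one by blast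
  qed
  have "left_deriv \<phi> 1 = D"
    unfolding left_deriv_def
  proof (rule the_equality)
    show der: "(\<phi> has_real_derivative D) (at_left 1)"
      using lim by (simp add: has_field_derivative_iff p_def[abs_def] d(5))
    fix D' assume "(\<phi> has_real_derivative D') (at_left 1)"
    then have "(p \<longlongrightarrow> D') (at_left 1)" by (simp add: has_field_derivative_iff p_def[abs_def] d(5))
    then show "D' = D" using lim by (intro tendsto_unique[OF trivial_limit_at_left_real])
  qed
  then show "((\<lambda>y. (\<phi> y - 1) / (y - 1)) \<longlongrightarrow> left_deriv \<phi> 1) (at_left 1)"
    "1 \<le> left_deriv \<phi> 1" "\<And>y. 0 \<le> y \<Longrightarrow> y \<le> 1 \<Longrightarrow> 1 - left_deriv \<phi> 1 * (1 - y) \<le> \<phi> y"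
  proof -
    assume D: "left_deriv \<phi> 1 = D"
    show "((\<lambda>y. (\<phi> y - 1) / (y - 1)) \<longlongrightarrow> left_deriv \<phi> 1) (at_left 1)"
      using lim unfolding D p_def .
    show "1 \<le> left_deriv \<phi> 1" using le[of 0] unfolding D by (simp add: p_def d(4))
    fix y :: real assume y: "0 \<le> y" "y \<le> 1"
    show "1 - left_deriv \<phi> 1 * (1 - y) \<le> \<phi> y"
    proof (cases "y = 1")
      case False
      then have "(\<phi> y - 1) / (y - 1) \<le> D" using le[of y] y by (simp add: p_def)
      then have "D * (y - 1) \<le> \<phi> y - 1" using False y by (simp add: neg_divide_le_eq)
      then show ?thesis unfolding D by (simp add: algebra_simps)
    qed (simp add: d(5))
  qed
qed

text \<open>The support function of the combination depends on the direction only through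
  \<open>a\<close> and \<open>b\<close>, the values of the two support functions; sublinearity and
  the expansion become facts about two real variables.\<close>

definition orlicz_root :: "(real \<Rightarrow> real) \<Rightarrow> (real \<Rightarrow> real) \<Rightarrow> real \<Rightarrow> real \<Rightarrow> real \<Rightarrow> real" where
  "orlicz_root \<phi> \<psi> \<epsilon> a b = Inf {l. 0 < l \<and> \<phi> (a / l) + \<epsilon> * \<psi> (b / l) \<le> 1}"

lemma orlicz_comb_support_eq_root:
  "orlicz_comb_support \<phi> \<psi> \<epsilon> K L x = orlicz_root \<phi> \<psi> \<epsilon> (support_function K x) (support_function L x)"
  by (simp add: orlicz_comb_support_def orlicz_root_def)

section \<open>Monotonicity and sublinearity of the scalar combination\<close>

context
  fixes \<phi> \<psi> :: "real \<Rightarrow> real"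
  assumes \<phi>: "\<phi> \<in> orlicz_class" and \<psi>: "\<psi> \<in> orlicz_class"
begin

lemma orlicz_root_le:
  assumes "0 < l" "\<phi> (a / l) + \<epsilon> * \<psi> (b / l) \<le> 1"
  shows "orlicz_root \<phi> \<psi> \<epsilon> a b \<le> l"
  unfolding orlicz_root_def using assms by (intro cInf_lower bdd_belowI[of _ 0]) auto

lemma orlicz_root_admissible_ex:
  assumes "0 \<le> a" "0 \<le> b" "0 \<le> \<epsilon>"
  shows "\<exists>l>0. \<phi> (a / l) + \<epsilon> * \<psi> (b / l) \<le> 1"
proof -
  \<comment> \<open>This \<open>l\<close> makes both quotients at most 1, where Orlicz functions lie
    below the identity, and also dominates \<open>a + \<epsilon> * b\<close>.\<close>
  define l where "l = a + b + \<epsilon> * b + 1"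
  have "0 \<le> \<epsilon> * b" using assms by simp
  then have l: "0 < l" "a \<le> l" "b \<le> l" "a + \<epsilon> * b \<le> l" using assms unfolding l_def by linarith+
  have "\<phi> (a / l) \<le> a / l" "\<psi> (b / l) \<le> b / l"
    using assms l by (intro orlicz_class_le_self[OF \<phi>] orlicz_class_le_self[OF \<psi>]; simp)+
  then have "\<phi> (a / l) + \<epsilon> * \<psi> (b / l) \<le> a / l + \<epsilon> * (b / l)"
    using assms by (intro add_mono mult_left_mono)
  also have "\<dots> = (a + \<epsilon> * b) / l" by (simp add: add_divide_distrib)
  also have "\<dots> \<le> 1" using l by simp
  finally show ?thesis using l(1) by blast
qed

lemma orlicz_root_geI:
  assumes "0 \<le> a" "0 \<le> b" "0 \<le> \<epsilon>"
    and "\<And>l. 0 < l \<Longrightarrow> \<phi> (a / l) + \<epsilon> * \<psi> (b / l) \<le> 1 \<Longrightarrow> c \<le> l"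
  shows "c \<le> orlicz_root \<phi> \<psi> \<epsilon> a b"
  unfolding orlicz_root_def using orlicz_root_admissible_ex[OF assms(1-3)] assms(4) by (intro cInf_greatest) auto

lemma orlicz_root_admissible_ge:
  assumes "0 \<le> b" "0 \<le> \<epsilon>" "0 < l" "\<phi> (a / l) + \<epsilon> * \<psi> (b / l) \<le> 1"
  shows "a \<le> l"
proof (rule ccontr)
  assume "\<not> a \<le> l"
  then have "1 < a / l" using assms by simp
  then have "1 < \<phi> (a / l)" using orlicz_class_ge_self[OF \<phi>, of "a / l"] by simp
  moreover have "0 \<le> \<epsilon> * \<psi> (b / l)" using assms orlicz_classD(3)[OF \<psi>] by simp
  ultimately show False using assms by simp
qed

lemma orlicz_root_ge:
  assumes "0 \<le> a" "0 \<le> b" "0 \<le> \<epsilon>"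
  shows "a \<le> orlicz_root \<phi> \<psi> \<epsilon> a b"
  by (rule orlicz_root_geI[OF assms]) (rule orlicz_root_admissible_ge[OF assms(2,3)])

lemma orlicz_root_mono:
  assumes "0 \<le> a" "a \<le> a'" "0 \<le> b" "b \<le> b'" "0 \<le> \<epsilon>"
  shows "orlicz_root \<phi> \<psi> \<epsilon> a b \<le> orlicz_root \<phi> \<psi> \<epsilon> a' b'"
proof (rule orlicz_root_geI)
  fix l :: real assume l: "0 < l" "\<phi> (a' / l) + \<epsilon> * \<psi> (b' / l) \<le> 1"
  have "\<phi> (a / l) + \<epsilon> * \<psi> (b / l) \<le> \<phi> (a' / l) + \<epsilon> * \<psi> (b' / l)"
    using assms l by (intro add_mono mult_left_mono orlicz_classD(2)[OF \<phi>] orlicz_classD(2)[OF \<psi>] divide_right_mono) auto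
  then show "orlicz_root \<phi> \<psi> \<epsilon> a b \<le> l" using l by (intro orlicz_root_le) auto
qed (use assms in auto)

text \<open>The sum of admissible values is admissible: the quotient of the sums is the convex
  combination of the two quotients with weights \<open>l / (l + l')\<close> and
  \<open>l' / (l + l')\<close>.\<close>

lemma orlicz_root_add:
  assumes a: "0 \<le> a" "0 \<le> a'" and b: "0 \<le> b" "0 \<le> b'" and \<epsilon>: "0 \<le> \<epsilon>"
  shows "orlicz_root \<phi> \<psi> \<epsilon> (a + a') (b + b') \<le> orlicz_root \<phi> \<psi> \<epsilon> a b + orlicz_root \<phi> \<psi> \<epsilon> a' b'"
proof -
  have adm: "orlicz_root \<phi> \<psi> \<epsilon> (a + a') (b + b') \<le> l + l'"
    if l: "0 < l" "\<phi> (a / l) + \<epsilon> * \<psi> (b / l) \<le> 1" and l': "0 < l'" "\<phi> (a' / l') + \<epsilon> * \<psi> (b' / l') \<le> 1" for l l'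
  proof (rule orlicz_root_le)
    define t where "t = l' / (l + l')"
    have t: "0 \<le> t" "t \<le> 1" using l l' by (simp_all add: t_def)
    have "l + l' \<noteq> 0" using l l' by simp
    then have t': "1 - t = l / (l + l')" by (simp add: t_def field_simps)
    have split: "(c + c') / (l + l') = (1 - t) *\<^sub>R (c / l) + t *\<^sub>R (c' / l')" for c c' :: real
      unfolding t' using l l' by (simp add: t_def add_divide_distrib)
    have "\<phi> ((a + a') / (l + l')) + \<epsilon> * \<psi> ((b + b') / (l + l')) \<le>
        ((1 - t) * \<phi> (a / l) + t * \<phi> (a' / l')) + \<epsilon> * ((1 - t) * \<psi> (b / l) + t * \<psi> (b' / l'))"
      unfolding split using t a b l l' \<epsilon>
      by (intro add_mono mult_left_mono convex_onD[OF orlicz_classD(1)[OF \<phi>]] convex_onD[OF orlicz_classD(1)[OF \<psi>]]) auto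
    also have "\<dots> = (1 - t) * (\<phi> (a / l) + \<epsilon> * \<psi> (b / l)) + t * (\<phi> (a' / l') + \<epsilon> * \<psi> (b' / l'))"
      by (simp add: algebra_simps)
    also have "\<dots> \<le> (1 - t) * 1 + t * 1"
      using t l l' by (intro add_mono mult_left_mono) auto
    finally show "\<phi> ((a + a') / (l + l')) + \<epsilon> * \<psi> ((b + b') / (l + l')) \<le> 1" by simp
  qed (use l l' in simp)
  \<comment> \<open>The infimum is taken over \<open>l\<close> with \<open>l'\<close> fixed, and
    afterwards over \<open>l'\<close>.\<close>
  have "orlicz_root \<phi> \<psi> \<epsilon> (a + a') (b + b') - l' \<le> orlicz_root \<phi> \<psi> \<epsilon> a b"
    if l': "0 < l'" "\<phi> (a' / l') + \<epsilon> * \<psi> (b' / l') \<le> 1" for l'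
  proof (rule orlicz_root_geI[OF a(1) b(1) \<epsilon>])
    fix l assume "0 < l" "\<phi> (a / l) + \<epsilon> * \<psi> (b / l) \<le> 1"
    from adm[OF this l'] show "orlicz_root \<phi> \<psi> \<epsilon> (a + a') (b + b') - l' \<le> l" by simp
  qed
  then have "orlicz_root \<phi> \<psi> \<epsilon> (a + a') (b + b') - orlicz_root \<phi> \<psi> \<epsilon> a b \<le> orlicz_root \<phi> \<psi> \<epsilon> a' b'"
    by (intro orlicz_root_geI[OF a(2) b(2) \<epsilon>]) (simp add: algebra_simps)
  then show ?thesis by simp
qed

lemma orlicz_root_zero: "orlicz_root \<phi> \<psi> \<epsilon> 0 0 = 0"
proof -
  have "{l. 0 < l \<and> \<phi> (0 / l) + \<epsilon> * \<psi> (0 / l) \<le> 1} = {0<..}"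
    using orlicz_classD(4)[OF \<phi>] orlicz_classD(4)[OF \<psi>] by auto
  then show ?thesis unfolding orlicz_root_def by simp
qed

lemma orlicz_root_scale:
  assumes a: "0 \<le> a" and b: "0 \<le> b" and \<epsilon>: "0 \<le> \<epsilon>" and c: "0 \<le> c"
  shows "orlicz_root \<phi> \<psi> \<epsilon> (c * a) (c * b) = c * orlicz_root \<phi> \<psi> \<epsilon> a b"
proof (cases "c = 0")
  case False
  \<comment> \<open>Shown for every positive factor, so that the reverse inequality is the same one
    for \<open>inverse c\<close>.\<close>
  have le: "orlicz_root \<phi> \<psi> \<epsilon> (c * a) (c * b) \<le> c * orlicz_root \<phi> \<psi> \<epsilon> a b"
    if a: "0 \<le> a" and b: "0 \<le> b" and c: "0 < c" for a b c
  proof -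
    have "orlicz_root \<phi> \<psi> \<epsilon> (c * a) (c * b) / c \<le> orlicz_root \<phi> \<psi> \<epsilon> a b"
    proof (rule orlicz_root_geI[OF a b \<epsilon>])
      fix l :: real assume "0 < l" "\<phi> (a / l) + \<epsilon> * \<psi> (b / l) \<le> 1"
      then have "orlicz_root \<phi> \<psi> \<epsilon> (c * a) (c * b) \<le> c * l"
        using c by (intro orlicz_root_le) auto
      then show "orlicz_root \<phi> \<psi> \<epsilon> (c * a) (c * b) / c \<le> l" using c by (simp add: field_simps)
    qed
    then show ?thesis using c by (simp add: field_simps)
  qed
  from False c have c: "0 < c" by simp
  have "orlicz_root \<phi> \<psi> \<epsilon> (inverse c * (c * a)) (inverse c * (c * b)) \<le> inverse c * orlicz_root \<phi> \<psi> \<epsilon> (c * a) (c * b)"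
    using a b c by (intro le) auto
  then have "c * orlicz_root \<phi> \<psi> \<epsilon> a b \<le> orlicz_root \<phi> \<psi> \<epsilon> (c * a) (c * b)"
    using c by (simp add: field_simps flip: mult.assoc)
  then show ?thesis using le[OF a b c] by simp
qed (simp add: orlicz_root_zero)

end

section \<open>First-order expansion of the scalar combination\<close>

context
  fixes \<phi> \<psi> :: "real \<Rightarrow> real"
  assumes \<phi>: "\<phi> \<in> orlicz_class" and \<psi>: "\<psi> \<in> orlicz_class"
begin

text \<open>The right-hand side is itself admissible for small \<open>\<epsilon>\<close>. With
  \<open>l = a + \<epsilon> * w\<close> the left slope gives \<open>\<phi> (a / l)\<close> about
  \<open>1 - D * \<epsilon> * w / l\<close>, so admissibility amounts to
  \<open>l * Q \<le> D * w\<close> up to error, and \<open>D * w = a * Q + D * \<eta>\<close> leaves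
  a slack of \<open>D * \<eta>\<close>.\<close>

lemma orlicz_root_upper_asymptotic:
  assumes r: "0 < r" and \<eta>: "0 < \<eta>"
  shows "eventually (\<lambda>\<epsilon>. \<forall>a\<in>{r..R}. \<forall>b\<in>{0..R'}.
      orlicz_root \<phi> \<psi> \<epsilon> a b \<le> a + \<epsilon> * (a * \<psi> (b / a) / left_deriv \<phi> 1 + \<eta>)) (at_right 0)"
proof (cases "r \<le> R \<and> 0 \<le> R'")
  case True
  define D where "D = left_deriv \<phi> 1"
  have D: "0 < D" using orlicz_class_left_deriv(2)[OF \<phi>] by (simp add: D_def)
  define P where "P = \<psi> (R' / r)"
  define \<Gamma> where "\<Gamma> = R * P / D + \<eta>"
  have P: "0 \<le> P" unfolding P_def using True r by (intro orlicz_classD(3)[OF \<psi>]) simp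
  then have \<Gamma>: "0 < \<Gamma>" using True r D \<eta> by (simp add: \<Gamma>_def add_nonneg_pos)
  \<comment> \<open>Half of the slack \<open>D * \<eta>\<close> is spent on the slope, which is only
    known to exceed \<open>D - \<xi>\<close> near 1.\<close>
  define \<xi> where "\<xi> = D * \<eta> / (2 * \<Gamma>)"
  have \<xi>: "0 < \<xi>" "\<xi> * \<Gamma> = D * \<eta> / 2" using \<Gamma> D \<eta> by (simp_all add: \<xi>_def)
  have "eventually (\<lambda>y. D - \<xi> < (\<phi> y - 1) / (y - 1)) (at_left 1)"
    using order_tendstoD(1)[OF orlicz_class_left_deriv(1)[OF \<phi>]] \<xi> by (simp add: D_def)
  then obtain y0 where y0: "y0 < 1" "\<And>y. y0 < y \<Longrightarrow> y < 1 \<Longrightarrow> D - \<xi> < (\<phi> y - 1) / (y - 1)"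
    unfolding eventually_at_left_field by blast
  \<comment> \<open>The first bound keeps \<open>a / l\<close> above \<open>y0\<close>; the second
    spends the other half of the slack on \<open>\<epsilon> * w * Q\<close>, the difference of
    \<open>l * Q\<close> and \<open>a * Q\<close>. The summand 1 covers
    \<open>P = 0\<close>.\<close>
  define e0 where "e0 = min (r * (1 - y0) / \<Gamma>) (D * \<eta> / (2 * \<Gamma> * (P + 1)))"
  have e0: "0 < e0" using r y0(1) \<Gamma> D \<eta> P by (simp add: e0_def)
  have "orlicz_root \<phi> \<psi> \<epsilon> a b \<le> a + \<epsilon> * (a * \<psi> (b / a) / D + \<eta>)"
    if \<epsilon>: "0 < \<epsilon>" "\<epsilon> < e0" and ab: "a \<in> {r..R}" "b \<in> {0..R'}" for \<epsilon> a b
  proof (rule orlicz_root_le[OF \<phi> \<psi>])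
    have a: "0 < a" using ab r by simp
    define Q where "Q = \<psi> (b / a)"
    have "b / a \<le> R' / r" using ab r by (intro frac_le) auto
    then have Q: "0 \<le> Q" "Q \<le> P" unfolding Q_def P_def using ab a
      by (auto intro!: orlicz_classD(2,3)[OF \<psi>])
    define w where "w = a * Q / D + \<eta>"
    have "a * Q \<le> R * P" using ab a Q by (intro mult_mono) auto
    then have w: "0 < w" "w \<le> \<Gamma>" unfolding w_def \<Gamma>_def using a Q D \<eta>
      by (auto intro!: add_nonneg_pos divide_right_mono)
    define l where "l = a + \<epsilon> * w"
    have l: "a < l" "0 < l" using a \<epsilon> w by (simp_all add: l_def add_pos_pos)
    show "0 < a + \<epsilon> * (a * \<psi> (b / a) / D + \<eta>)" using l(2) by (simp add: l_def w_def Q_def)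
    have eG: "\<epsilon> * \<Gamma> < r * (1 - y0)"
      using \<epsilon> \<Gamma> by (simp add: e0_def pos_less_divide_eq)
    define y where "y = a / l"
    have y: "y < 1" "1 - y = \<epsilon> * w / l" using l by (simp_all add: y_def l_def field_simps)
    have "\<epsilon> * w \<le> \<epsilon> * \<Gamma>" using \<epsilon> w by simp
    also have "\<dots> < l * (1 - y0)"
    proof -
      have "r * (1 - y0) \<le> l * (1 - y0)" using ab l y0 by (intro mult_right_mono) auto
      then show ?thesis using eG by simp
    qed
    finally have "\<epsilon> * w / l < 1 - y0" using l by (simp add: pos_divide_less_eq mult.commute)
    then have "y0 < y" using y(2) by simp
    then have "D - \<xi> < (\<phi> y - 1) / (y - 1)" using y0(2) y(1) by blast
    then have "\<phi> y - 1 < (D - \<xi>) * (y - 1)" using y(1) by (simp add: neg_less_divide_eq)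
    then have 1: "\<phi> y < 1 - (D - \<xi>) * (\<epsilon> * w / l)" unfolding y(2)[symmetric] by (simp add: algebra_simps)
    have "\<psi> (b / l) \<le> Q" unfolding Q_def
      using ab a l by (intro orlicz_classD(2)[OF \<psi>] divide_left_mono) auto
    then have 2: "\<epsilon> * \<psi> (b / l) \<le> \<epsilon> * Q" using \<epsilon> by simp
    have "l * Q \<le> (D - \<xi>) * w"
    proof -
      have "\<epsilon> * (2 * \<Gamma> * (P + 1)) < D * \<eta>"
        using \<epsilon> \<Gamma> P by (simp add: e0_def pos_less_divide_eq)
      then have "\<epsilon> * \<Gamma> * (P + 1) < D * \<eta> / 2" by simp
      moreover have "\<epsilon> * w * Q \<le> \<epsilon> * \<Gamma> * (P + 1)"
        using \<epsilon> w Q by (intro mult_mono) auto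
      moreover have "\<xi> * w \<le> D * \<eta> / 2"
        using mult_left_mono[OF w(2), of \<xi>] \<xi> by simp
      moreover have "D * w = a * Q + D * \<eta>" using D by (simp add: w_def algebra_simps)
      ultimately show ?thesis by (simp add: l_def algebra_simps)
    qed
    then have "\<epsilon> * (l * Q) \<le> \<epsilon> * ((D - \<xi>) * w)" using \<epsilon> by simp
    then have "\<epsilon> * Q \<le> (D - \<xi>) * (\<epsilon> * w / l)" using l by (simp add: field_simps)
    with 1 2 have "\<phi> (a / l) + \<epsilon> * \<psi> (b / l) \<le> 1" by (simp add: y_def)
    then show "\<phi> (a / (a + \<epsilon> * (a * \<psi> (b / a) / D + \<eta>))) + \<epsilon> * \<psi> (b / (a + \<epsilon> * (a * \<psi> (b / a) / D + \<eta>))) \<le> 1"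
      by (simp add: l_def w_def Q_def)
  qed
  then show ?thesis
    unfolding eventually_at_right_field D_def[symmetric] using e0 by blast
qed auto

text \<open>The supporting line of \<open>\<phi>\<close> at 1 turns admissibility of
  \<open>l\<close> into \<open>\<epsilon> * l * \<psi> (b / l) \<le> D * (l - a)\<close>. It remains
  to replace \<open>b / l\<close> by \<open>b / a\<close>, for which uniform continuity of
  \<open>\<psi>\<close> is used.\<close>

lemma orlicz_root_lower_asymptotic:
  assumes r: "0 < r" and \<eta>: "0 < \<eta>"
  shows "eventually (\<lambda>\<epsilon>. \<forall>a\<in>{r..R}. \<forall>b\<in>{0..R'}.
      a + \<epsilon> * (a * \<psi> (b / a) / left_deriv \<phi> 1 - \<eta>) \<le> orlicz_root \<phi> \<psi> \<epsilon> a b) (at_right 0)"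
proof (cases "r \<le> R \<and> 0 \<le> R'")
  case True
  define D where "D = left_deriv \<phi> 1"
  have D: "0 < D" using orlicz_class_left_deriv(2)[OF \<phi>] by (simp add: D_def)
  define P where "P = \<psi> (R' / r)"
  define \<Gamma> where "\<Gamma> = R * P / D"
  have P: "0 \<le> P" unfolding P_def using True r by (intro orlicz_classD(3)[OF \<psi>]) simp
  then have \<Gamma>: "0 \<le> \<Gamma>" using True r D \<eta> by (simp add: \<Gamma>_def)
  \<comment> \<open>An error \<open>\<zeta>\<close> in \<open>\<psi>\<close> is multiplied by
    \<open>a\<close>, at most \<open>R\<close>, and divided by \<open>D\<close>, which makes
    \<open>\<eta>\<close>.\<close>
  define \<zeta> where "\<zeta> = D * \<eta> / R"
  have R: "0 < R" using True r by simp
  have \<zeta>: "0 < \<zeta>" using D \<eta> R by (simp add: \<zeta>_def)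
  have "uniformly_continuous_on {0..R' / r} \<psi>"
    by (intro compact_uniformly_continuous continuous_on_subset[OF orlicz_class_continuous[OF \<psi>]]) auto
  then obtain \<rho> where \<rho>: "0 < \<rho>"
    "\<And>s t. s \<in> {0..R' / r} \<Longrightarrow> t \<in> {0..R' / r} \<Longrightarrow> dist t s < \<rho> \<Longrightarrow> dist (\<psi> t) (\<psi> s) < \<zeta>"
    unfolding uniformly_continuous_on_def using \<zeta> by metis
  define e0 where "e0 = \<rho> * r * r / (R' * \<Gamma> + 1)"
  have RG: "0 < R' * \<Gamma> + 1" using True \<Gamma> by (intro add_nonneg_pos) auto
  then have e0: "0 < e0" using \<rho>(1) r by (simp add: e0_def)
  have "a + \<epsilon> * (a * \<psi> (b / a) / D - \<eta>) \<le> orlicz_root \<phi> \<psi> \<epsilon> a b"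
    if \<epsilon>: "0 < \<epsilon>" "\<epsilon> < e0" and ab: "a \<in> {r..R}" "b \<in> {0..R'}" for \<epsilon> a b
  proof (rule orlicz_root_geI[OF \<phi> \<psi>])
    fix l assume l: "0 < l" "\<phi> (a / l) + \<epsilon> * \<psi> (b / l) \<le> 1"
    have a: "0 < a" using ab r by simp
    have al: "a \<le> l" by (rule orlicz_root_admissible_ge[OF \<phi> \<psi> _ _ l]) (use ab \<epsilon> in auto)
    define Q where "Q = \<psi> (b / a)"
    have bar: "b / a \<le> R' / r" using ab r by (intro frac_le) auto
    then have Q: "0 \<le> Q" "Q \<le> P" unfolding Q_def P_def using ab a
      by (auto intro!: orlicz_classD(2,3)[OF \<psi>])
    have "a * Q \<le> R * P" using ab a Q by (intro mult_mono) auto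
    then have w: "a * Q / D \<le> \<Gamma>" unfolding \<Gamma>_def using D by (intro divide_right_mono) auto
    \<comment> \<open>If \<open>l\<close> exceeds \<open>a + \<epsilon> * \<Gamma>\<close> the claim
      is immediate. Otherwise \<open>l\<close> is close to \<open>a\<close>, and \<open>e0\<close>
      is chosen so that \<open>b / l\<close> is within \<open>\<rho>\<close> of
      \<open>b / a\<close>.\<close>
    have "\<epsilon> * (a * Q / D - \<eta>) \<le> l - a"
    proof (cases "l \<le> a + \<epsilon> * \<Gamma>")
      case False
      have "\<epsilon> * (a * Q / D - \<eta>) \<le> \<epsilon> * \<Gamma>" using w \<eta> \<epsilon> by (intro mult_left_mono) auto
      then show ?thesis using False by simp
    next
      case True
      have bl: "b / l \<le> b / a" "0 \<le> b / l" using ab al a l by (auto intro!: divide_left_mono)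
      have "b / a - b / l = b * (l - a) / (a * l)" using a l by (simp add: field_simps)
      also have "\<dots> \<le> R' * (\<epsilon> * \<Gamma>) / (r * r)"
        using ab al a r True \<epsilon> \<Gamma> by (intro frac_le mult_mono) auto
      also have "\<dots> < \<rho>"
      proof -
        have "\<epsilon> * (R' * \<Gamma> + 1) < \<rho> * r * r" using \<epsilon> RG by (simp add: e0_def pos_less_divide_eq)
        then have "R' * (\<epsilon> * \<Gamma>) < \<rho> * (r * r)" using \<epsilon> by (simp add: algebra_simps)
        then show ?thesis using r by (simp add: pos_divide_less_eq)
      qed
      finally have "dist (b / l) (b / a) < \<rho>" using bl by (simp add: dist_real_def)
      then have "dist (\<psi> (b / l)) Q < \<zeta>" unfolding Q_def
        using bl bar ab a by (intro \<rho>(2)) auto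
      then have Ql: "Q - \<zeta> \<le> \<psi> (b / l)" by (simp add: dist_real_def)
      have "1 - D * (1 - a / l) \<le> \<phi> (a / l)"
        unfolding D_def using a al l by (intro orlicz_class_left_deriv(3)[OF \<phi>]) auto
      then have "\<epsilon> * \<psi> (b / l) \<le> D * (1 - a / l)" using l(2) by simp
      then have "l * (\<epsilon> * \<psi> (b / l)) \<le> l * (D * (1 - a / l))" using l by simp
      also have "\<dots> = D * (l - a)" using l by (simp add: field_simps)
      finally have 1: "\<epsilon> * (l * \<psi> (b / l)) \<le> D * (l - a)" by (simp add: algebra_simps)
      have "a * Q - D * \<eta> \<le> a * (Q - \<zeta>)"
      proof -
        have "a * \<zeta> \<le> R * \<zeta>" using ab \<zeta> by (intro mult_right_mono) auto
        also have "\<dots> = D * \<eta>" using R by (simp add: \<zeta>_def)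
        finally show ?thesis by (simp add: algebra_simps)
      qed
      also have "\<dots> \<le> a * \<psi> (b / l)" using Ql a by simp
      also have "\<dots> \<le> l * \<psi> (b / l)"
        using al orlicz_classD(3)[OF \<psi> bl(2)] by (intro mult_right_mono)
      finally have "\<epsilon> * (a * Q - D * \<eta>) \<le> \<epsilon> * (l * \<psi> (b / l))" using \<epsilon> by simp
      with 1 have "\<epsilon> * (a * Q - D * \<eta>) \<le> D * (l - a)" by linarith
      then have "\<epsilon> * (a * Q - D * \<eta>) / D \<le> l - a" using D by (simp add: pos_divide_le_eq mult.commute)
      also have "\<epsilon> * (a * Q - D * \<eta>) / D = \<epsilon> * (a * Q / D - \<eta>)" using D by (simp add: field_simps)
      finally show ?thesis .
    qed
    then show "a + \<epsilon> * (a * \<psi> (b / a) / D - \<eta>) \<le> l" by (simp add: Q_def)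
  qed (use ab r \<epsilon> in auto)
  then show ?thesis
    unfolding eventually_at_right_field D_def[symmetric] using e0 by blast
qed auto

end

section \<open>The Orlicz combination as a convex body\<close>

lemma support_function_nonneg:
  assumes "compact K" "0 \<in> K"
  shows "0 \<le> support_function K x"
  using support_function_ge[OF assms, of x] by simp

text \<open>The definite description denotes a body because its prescribed support function is
  sublinear, and bodies are determined by support functions. Since the origin lies in both sets, the
  arguments of \<open>orlicz_root\<close> are nonnegative, where it is monotone and
  subadditive.\<close>

lemma orlicz_comb_props:
  fixes K L :: "'a::euclidean_space set"
  assumes \<phi>: "\<phi> \<in> orlicz_class" and \<psi>: "\<psi> \<in> orlicz_class"
    and K: "compact K" "convex K" "0 \<in> K" and L: "compact L" "convex L" "0 \<in> L" and \<epsilon>: "0 \<le> \<epsilon>"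
  shows "compact (orlicz_comb \<phi> \<psi> \<epsilon> K L)" "convex (orlicz_comb \<phi> \<psi> \<epsilon> K L)" "K \<subseteq> orlicz_comb \<phi> \<psi> \<epsilon> K L"
    "support_function (orlicz_comb \<phi> \<psi> \<epsilon> K L) x = orlicz_root \<phi> \<psi> \<epsilon> (support_function K x) (support_function L x)"
proof -
  have ne: "K \<noteq> {}" "L \<noteq> {}" using K L by auto
  define h where "h = orlicz_comb_support \<phi> \<psi> \<epsilon> K L"
  define M where "M = {y. \<forall>x. x \<bullet> y \<le> h x}"
  note pos = support_function_nonneg[OF K(1,3)] support_function_nonneg[OF L(1,3)]
  have add: "h (x + y) \<le> h x + h y" for x y
  proof -
    have "h (x + y) \<le> orlicz_root \<phi> \<psi> \<epsilon> (support_function K x + support_function K y) (support_function L x + support_function L y)"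
      unfolding h_def orlicz_comb_support_eq_root
      using K L ne \<epsilon> pos by (intro orlicz_root_mono[OF \<phi> \<psi>] support_function_sublinear(1)) auto
    also have "\<dots> \<le> h x + h y"
      unfolding h_def orlicz_comb_support_eq_root using \<epsilon> pos by (intro orlicz_root_add[OF \<phi> \<psi>])
    finally show ?thesis .
  qed
  have scale: "h (c *\<^sub>R x) = c * h x" if "0 \<le> c" for c x
    unfolding h_def orlicz_comb_support_eq_root
      support_function_sublinear(2)[OF K(1) ne(1) that] support_function_sublinear(2)[OF L(1) ne(2) that]
    using \<epsilon> pos that by (intro orlicz_root_scale[OF \<phi> \<psi>])
  note M = sublinear_is_support_function[of h, OF add scale, folded M_def]
  have "orlicz_comb \<phi> \<psi> \<epsilon> K L = M"
    unfolding orlicz_comb_def h_def[symmetric]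
  proof (rule the_equality)
    show "compact M \<and> convex M \<and> M \<noteq> {} \<and> (\<forall>x. support_function M x = h x)" using M by blast
    fix M' assume M': "compact M' \<and> convex M' \<and> M' \<noteq> {} \<and> (\<forall>x. support_function M' x = h x)"
    then show "M' = M" using M by (intro support_function_inject) auto
  qed
  moreover have "K \<subseteq> M"
  proof
    fix y assume "y \<in> K"
    have "x \<bullet> y \<le> h x" for x
    proof -
      have "x \<bullet> y \<le> support_function K x" by (rule support_function_ge[OF K(1) \<open>y \<in> K\<close>])
      also have "\<dots> \<le> h x" unfolding h_def orlicz_comb_support_eq_root
        by (rule orlicz_root_ge[OF \<phi> \<psi> pos \<epsilon>])
      finally show ?thesis .
    qed
    then show "y \<in> M" by (simp add: M_def)
  qed
  ultimately show "compact (orlicz_comb \<phi> \<psi> \<epsilon> K L)" "convex (orlicz_comb \<phi> \<psi> \<epsilon> K L)" "K \<subseteq> orlicz_comb \<phi> \<psi> \<epsilon> K L"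
    "support_function (orlicz_comb \<phi> \<psi> \<epsilon> K L) x = orlicz_root \<phi> \<psi> \<epsilon> (support_function K x) (support_function L x)"
    using M by (simp_all add: h_def orlicz_comb_support_eq_root)
qed

text \<open>This is where the interior origin enters: \<open>r\<close> is the radius of a ball about
  0 inside \<open>K\<close>, and it keeps quotients by the support function bounded and
  continuous.\<close>

lemma support_function_bounds_sphere:
  fixes K :: "'a::euclidean_space set"
  assumes K: "compact K" "0 \<in> interior K"
  obtains r R where "0 < r" "\<And>u. u \<in> sphere 0 1 \<Longrightarrow> support_function K u \<in> {r..R}"
proof -
  obtain r where r: "0 < r" "cball 0 r \<subseteq> K" using K(2) by (auto simp: mem_interior_cball)
  obtain R where R: "\<And>y. y \<in> K \<Longrightarrow> norm y \<le> R" using compact_imp_bounded[OF K(1)] bounded_iff by blast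
  have "support_function K u \<in> {r..R}" if u: "u \<in> sphere 0 1" for u
  proof -
    have "r *\<^sub>R u \<in> K" using r u by auto
    from support_function_ge[OF K(1) this, of u] have "r \<le> support_function K u"
      using u by (simp add: dot_square_norm)
    moreover have "support_function K u \<le> R"
    proof (rule support_function_le)
      show "K \<noteq> {}" using r by auto
      fix y assume "y \<in> K"
      then show "u \<bullet> y \<le> R" using norm_cauchy_schwarz[of u y] R u by force
    qed
    ultimately show ?thesis by simp
  qed
  with r(1) that show thesis by blast
qed

section \<open>The variational formula\<close>

theorem theorem8p5:
  fixes \<phi>1 \<phi>2 :: "real \<Rightarrow> real" and K L :: "(real ^ 'n) set"
  assumes "CARD('n) \<ge> 2"
    and "\<phi>1 \<in> orlicz_class" and "\<phi>2 \<in> orlicz_class"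
    and "compact K" and "convex K" and "0 \<in> interior K"
    and "compact L" and "convex L" and "0 \<in> L"
  shows "\<exists>l::real.
           ((\<lambda>\<epsilon>. (volume (orlicz_comb \<phi>1 \<phi>2 \<epsilon> K L) - volume K) / \<epsilon>) \<longlongrightarrow> l) (at_right 0) \<and>
           orlicz_mixed_volume \<phi>2 K L = left_deriv \<phi>1 1 / real CARD('n) * l"
proof -
  note \<phi> = assms(2) and \<psi> = assms(3)
  have K: "compact K" "convex K" "K \<noteq> {}" "0 \<in> K" using assms interior_subset[of K] by auto
  have L: "compact L" "L \<noteq> {}" using assms by auto
  define D where "D = left_deriv \<phi>1 1"
  have D: "0 < D" using orlicz_class_left_deriv(2)[OF \<phi>] by (simp add: D_def)
  obtain r R where r: "0 < r" and R: "\<And>u. u \<in> sphere 0 1 \<Longrightarrow> support_function K u \<in> {r..R}"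
    using support_function_bounds_sphere[OF K(1) assms(6)] by blast
  have cont: "continuous_on (sphere 0 1) (support_function A)" if "compact A" "A \<noteq> {}" for A :: "(real ^ 'n) set"
    using continuous_on_subset[OF sublinear_convex_continuous(2)[OF support_function_sublinear[OF that]]] by simp
  note contK = cont[OF K(1,3)] and contL = cont[OF L]
  obtain R' where "\<And>u. u \<in> sphere 0 1 \<Longrightarrow> \<bar>support_function L u\<bar> \<le> R'"
    using continuous_on_sphere_bounded[OF contL] by metis
  then have R': "support_function L u \<in> {0..R'}" if "u \<in> sphere 0 1" for u
    using support_function_nonneg[OF assms(7,9), of u] that by fastforce
  \<comment> \<open>\<open>f\<close> is the integrand of the mixed volume and
    \<open>g = f / D\<close> the first-order coefficient of the support functions; the factor
    \<open>D\<close> in the theorem restores \<open>f\<close>.\<close>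
  define f where "f u = \<phi>2 (support_function L u / support_function K u) * support_function K u" for u
  define g where "g u = f u / D" for u
  define V where "V = (\<integral>u. g u \<partial>surface_area_measure K)"
  have pos: "0 < support_function K u" "0 \<le> support_function L u / support_function K u" if "u \<in> sphere 0 1" for u
    using R[OF that] R'[OF that] r by auto
  have g: "continuous_on (sphere 0 1) g"
    unfolding g_def f_def using pos(1) pos(2) D
    by (intro continuous_intros contK contL continuous_on_compose2[OF orlicz_class_continuous[OF \<psi>]]) fastforce+
  have g0: "0 \<le> g u" if "u \<in> sphere 0 1" for u
    unfolding g_def f_def using orlicz_classD(3)[OF \<psi> pos(2)[OF that]] pos(1)[OF that] D by simp
  have asym: "eventually (\<lambda>\<epsilon>. \<forall>u\<in>sphere 0 1. \<bar>support_function (orlicz_comb \<phi>1 \<phi>2 \<epsilon> K L) u - support_function K u - \<epsilon> * g u\<bar> \<le> \<epsilon> * \<eta>) (at_right 0)"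
    if \<eta>: "0 < \<eta>" for \<eta>
    using orlicz_root_upper_asymptotic[OF \<phi> \<psi> r \<eta>, of R R'] orlicz_root_lower_asymptotic[OF \<phi> \<psi> r \<eta>, of R R']
      eventually_at_right_less[of "0::real"]
  proof eventually_elim
    case (elim \<epsilon>)
    show ?case
    proof
      fix u :: "real ^ 'n" assume u: "u \<in> sphere 0 1"
      have "support_function (orlicz_comb \<phi>1 \<phi>2 \<epsilon> K L) u = orlicz_root \<phi>1 \<phi>2 \<epsilon> (support_function K u) (support_function L u)"
        using elim(3) by (intro orlicz_comb_props(4) assms K) auto
      moreover have "support_function K u * \<phi>2 (support_function L u / support_function K u) / left_deriv \<phi>1 1 = g u"
        by (simp add: g_def f_def D_def)
      ultimately show "\<bar>support_function (orlicz_comb \<phi>1 \<phi>2 \<epsilon> K L) u - support_function K u - \<epsilon> * g u\<bar> \<le> \<epsilon> * \<eta>"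
        using bspec[OF bspec[OF elim(1) R[OF u]] R'[OF u]] bspec[OF bspec[OF elim(2) R[OF u]] R'[OF u]]
        by (simp add: algebra_simps abs_le_iff)
    qed
  qed
  have "((\<lambda>\<epsilon>. (volume (orlicz_comb \<phi>1 \<phi>2 \<epsilon> K L) - volume K) / \<epsilon>) \<longlongrightarrow> V) (at_right 0)"
  proof (rule tendsto_at_right_sequentially[OF zero_less_one])
    fix S :: "nat \<Rightarrow> real" assume S: "\<And>n. 0 < S n" "S \<longlonglongrightarrow> 0"
    have "S n \<noteq> 0" for n using S(1)[of n] by simp
    then have lim: "filterlim S (at_right 0) sequentially"
      unfolding filterlim_at using S by (auto intro: always_eventually)
    show "(\<lambda>n. (volume (orlicz_comb \<phi>1 \<phi>2 (S n) K L) - volume K) / S n) \<longlonglongrightarrow> V"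
      unfolding volume_def V_def
    proof (rule volume_variation[OF K(1-3) g _ _ _ _ S])
      note props = orlicz_comb_props[OF \<phi> \<psi> K(1,2,4) assms(7-9) less_imp_le[OF S(1)]]
      show "compact (orlicz_comb \<phi>1 \<phi>2 (S i) K L)" "convex (orlicz_comb \<phi>1 \<phi>2 (S i) K L)"
        "K \<subseteq> orlicz_comb \<phi>1 \<phi>2 (S i) K L" for i
        by (fact props)+
      show "eventually (\<lambda>i. \<forall>u\<in>sphere 0 1. \<bar>support_function (orlicz_comb \<phi>1 \<phi>2 (S i) K L) u - support_function K u - S i * g u\<bar> \<le> S i * \<eta>) sequentially"
        if "0 < \<eta>" for \<eta>
        by (rule eventually_compose_filterlim[OF asym[OF that] lim])
    qed (rule g0)
  qed
  moreover have "orlicz_mixed_volume \<phi>2 K L = left_deriv \<phi>1 1 / real CARD('n) * V"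
    using D unfolding orlicz_mixed_volume_def V_def g_def f_def D_def[symmetric] by simp
  ultimately show ?thesis by blast
qed

end
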